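(* Let $1\le j<k\le M$ and $0<x<1$. Let $Y$ and $Z$ be, respectively, the $j$-th largest and the $k$-th largest among the SNRs $X_1,\dots,X_M$. Then the joint outage probability $$\Pi^{(k,j)}_{\rm SBS}(x)=\mathbb P\left\{\frac{Z}{Y+\sigma_n^2}\le x\ \text{ and }\ \frac{Y}{Z+\sigma_n^2}\le x\right\}$$ is $$\Pi^{(k,j)}_{\rm SBS}(x)=\int_0^{\frac{\sigma_n^2x}{1-x}}\int_{\max\left\{z,\frac{z-\sigma_n^2x}{x}\right\}}^{x(z+\sigma_n^2)}p(y,z)\,dy\,dz,$$ where, for $0<z<y$, $$p(y,z)=\frac{M!}{(j-1)!\,(k-j-1)!\,(M-k)!}\,(1-F(y))^{j-1}f(y)\,(F(y)-F(z))^{k-j-1}f(z)\,F(z)^{M-k},$$ with $F$ the CDF of $X_i$, $$F(u)=1-2\sqrt{\frac{\sigma_n^2c^2t_2u}{P_tt_1(ac-b)}}\;\exp\left(-\frac{\sigma_n^2ct_2u}{t_1(ac-b)}\right)K_1\left(2\sqrt{\frac{\sigma_n^2c^2t_2u}{P_tt_1(ac-b)}}\right)\quad(u>0),$$ and $f=F'$ its density.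
   Context: There are $M\ge 2$ devices. The channel gains $|g_1|^2,\dots,|g_M|^2,|h_1|^2,\dots,|h_M|^2$ are independent exponential random variables with mean $1$. Parameters: $P_t>0$, $\sigma_n^2>0$, $0<t_1<1$, $t_2=1-t_1$, and real constants $a,b,c$ with $c>0$ and $ac-b>0$. The energy harvested by device $i$ is $E_i=t_1\left(\frac{aP_t|g_i|^2+b}{P_t|g_i|^2+c}-\frac bc\right)$, and the SNR of device $i$ is $X_i=\frac{|h_i|^2}{t_2\sigma_n^2}E_i$. Two devices (those with the $j$-th and $k$-th largest SNR) transmit simultaneously with single-user detection; joint outage at rate threshold $Q>0$ is the event that both $t_2\log_2(1+\mathrm{SINR})\le Q$, i.e. both SINRs are at most $x=2^{Q/t_2}-1$, where the SINR of each device is its SNR divided by (the other device's SNR plus $\sigma_n^2$). $K_1$ is the modified Bessel function of the second kind of order one. *)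

theory Defs
  imports "HOL-Probability.Probability"
begin

text \<open>
  Modified Bessel function of the second kind, by its integral representation, which
  converges for every real order \<open>\<nu>\<close> and argument \<open>x > 0\<close>.
\<close>

definition bessel_K :: "real \<Rightarrow> real \<Rightarrow> real" where
  "bessel_K \<nu> x = (LBINT t:{0..}. exp (- (x * cosh t)) * cosh (\<nu> * t))"

text \<open>
  Throughout, \<open>G\<close> and \<open>H\<close> are the squared magnitudes of the channel coefficients and
  \<open>s\<close> is the noise variance \<open>\<sigma>\<^sub>n\<^sup>2\<close> (not its root).
\<close>

definition harvested_energy ::
    "real \<Rightarrow> real \<Rightarrow> real \<Rightarrow> real \<Rightarrow> real \<Rightarrow> real \<Rightarrow> real" where
  "harvested_energy Pt t1 a b c G = t1 * ((a * Pt * G + b) / (Pt * G + c) - b / c)"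

definition snr ::
    "real \<Rightarrow> real \<Rightarrow> real \<Rightarrow> real \<Rightarrow> real \<Rightarrow> real \<Rightarrow> real \<Rightarrow> real \<Rightarrow> real \<Rightarrow> real" where
  "snr Pt s t1 t2 a b c G H = H / (t2 * s) * harvested_energy Pt t1 a b c G"

text \<open>The closed form of the SNR distribution function, meaningful for \<open>u > 0\<close>.\<close>

definition snr_cdf ::
    "real \<Rightarrow> real \<Rightarrow> real \<Rightarrow> real \<Rightarrow> real \<Rightarrow> real \<Rightarrow> real \<Rightarrow> real \<Rightarrow> real" where
  "snr_cdf Pt s t1 t2 a b c u =
     1 - 2 * sqrt (s * c\<^sup>2 * t2 * u / (Pt * t1 * (a * c - b)))
           * exp (- (s * c * t2 * u / (t1 * (a * c - b))))
           * bessel_K 1 (2 * sqrt (s * c\<^sup>2 * t2 * u / (Pt * t1 * (a * c - b))))"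

text \<open>The \<open>j\<close>-th largest of \<open>v 1, \<dots>, v n\<close>, counted with multiplicity, for \<open>1 \<le> j \<le> n\<close>.\<close>

definition nth_largest :: "nat \<Rightarrow> nat \<Rightarrow> (nat \<Rightarrow> real) \<Rightarrow> real" where
  "nth_largest n j v = rev (sort (map v [1..<Suc n])) ! (j - 1)"

definition order_stat_density ::
    "nat \<Rightarrow> nat \<Rightarrow> nat \<Rightarrow> (real \<Rightarrow> real) \<Rightarrow> (real \<Rightarrow> real) \<Rightarrow> real \<Rightarrow> real \<Rightarrow> real" where
  "order_stat_density n j k F f y z =
     fact n / (fact (j - 1) * fact (k - j - 1) * fact (n - k))
       * (1 - F y) ^ (j - 1) * f y * (F y - F z) ^ (k - j - 1) * f z * F z ^ (n - k)"

end

theory Submission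
  imports Defs "HOL-Real_Asymp.Real_Asymp"
begin

text \<open>
  Given the gain \<open>g\<close> of the harvesting channel, the SNR is exponential with rate \<open>A + B / g\<close>, so its
  density is a mixture of exponential densities. The tail of this mixture is
  \<open>exp (- A u)\<close> times the integral of \<open>exp (- g - B u / g)\<close> over \<open>g > 0\<close>, and the substitution
  \<open>g = sqrt (B u) * exp t\<close> turns the latter into the integral defining \<open>K\<^sub>1\<close>. The mixture density is
  continuous by dominated convergence, hence it is the derivative of the distribution function.

  For the joint law of two order statistics, ties have probability zero. Away from ties there are
  exactly one index realising the \<open>j\<close>-th and one realising the \<open>k\<close>-th largest value, one set of
  indices above and one between them. All such labellings are equally likely by Fubini's theorem,
  and the multinomial constant counts them. On the event of joint outage, \<open>z < y\<close> makes the condition on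
  the weaker device redundant, which leaves \<open>z < y \<le> x (z + s)\<close>.
\<close>

section \<open>Order statistics\<close>

text \<open>The entries of an increasing list that exceed \<open>t\<close> occupy a final segment,
  so their number tells where that segment begins.\<close>

lemma sorted_nth_gt_iff:
  fixes t :: "'a::linorder"
  assumes "sorted xs" "m < length xs"
  shows "t < xs ! m \<longleftrightarrow> length xs - m \<le> length (filter (\<lambda>x. t < x) xs)"
proof -
  let ?S = "{i. i < length xs \<and> t < xs ! i}"
  have len: "length (filter (\<lambda>x. t < x) xs) = card ?S"
    by (rule length_filter_conv_card)
  show ?thesis
  proof
    assume t: "t < xs ! m"
    have "{m..<length xs} \<subseteq> ?S"
    proof
      fix i assume i: "i \<in> {m..<length xs}"
      then have "xs ! m \<le> xs ! i"
        using assms by (intro sorted_nth_mono) auto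
      with t i show "i \<in> ?S"
        by auto
    qed
    then have "card {m..<length xs} \<le> card ?S"
      by (rule card_mono[rotated]) auto
    then show "length xs - m \<le> length (filter (\<lambda>x. t < x) xs)"
      by (simp add: len)
  next
    assume le: "length xs - m \<le> length (filter (\<lambda>x. t < x) xs)"
    show "t < xs ! m"
    proof (rule ccontr)
      assume nt: "\<not> t < xs ! m"
      have "?S \<subseteq> {m<..<length xs}"
      proof
        fix i assume i: "i \<in> ?S"
        have "m < i"
        proof (rule ccontr)
          assume "\<not> m < i"
          then have "xs ! i \<le> xs ! m"
            using assms by (intro sorted_nth_mono) auto
          with nt i show False
            by auto
        qed
        with i show "i \<in> {m<..<length xs}"
          by auto
      qed
      then have "card ?S \<le> card {m<..<length xs}"
        by (rule card_mono[rotated]) auto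
      with le assms show False
        by (auto simp: len)
    qed
  qed
qed

text \<open>Replaces sorting by counting: superlevel sets of \<open>nth_largest\<close> become
  conditions on how many coordinates exceed a threshold. Both the identification of ranks and
  measurability rest on this equivalence.\<close>

lemma nth_largest_gt_iff:
  assumes "1 \<le> j" "j \<le> n"
  shows "t < nth_largest n j v \<longleftrightarrow> j \<le> card {i\<in>{1..n}. t < v i}"
proof -
  let ?xs = "sort (map v [1..<Suc n])"
  have len: "length ?xs = n"
    by simp
  \<comment> \<open>Reversal of a list of length \<open>n\<close> sends position
    \<open>j - 1\<close> to \<open>n - 1 - (j - 1) = n - j\<close>, and
    \<open>n - (n - j) = j\<close> is then the required count.\<close>
  have nth: "nth_largest n j v = ?xs ! (n - j)"
    unfolding nth_largest_def using assms by (subst rev_nth) (auto simp del: upt_Suc)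
  have "length (filter (\<lambda>x. t < x) ?xs) = length (filter (\<lambda>i. t < v i) [1..<Suc n])"
    by (simp add: filter_sort filter_map o_def del: upt_Suc)
  also have "\<dots> = card (set (filter (\<lambda>i. t < v i) [1..<Suc n]))"
    by (subst distinct_card) (auto simp del: upt_Suc)
  also have "set (filter (\<lambda>i. t < v i) [1..<Suc n]) = {i\<in>{1..n}. t < v i}"
    by auto
  finally have card: "length (filter (\<lambda>x. t < x) ?xs) = card {i\<in>{1..n}. t < v i}" .
  show ?thesis
    unfolding nth using sorted_nth_gt_iff[of ?xs "n - j" t] assms
    unfolding card len by (simp del: upt_Suc)
qed

lemma nth_largest_cong:
  assumes "\<And>i. i \<in> {1..n} \<Longrightarrow> v i = w i"
  shows "nth_largest n j v = nth_largest n j w"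
proof -
  have "map v [1..<Suc n] = map w [1..<Suc n]"
    using assms by (intro map_cong refl) auto
  then show ?thesis
    by (simp only: nth_largest_def)
qed

lemma nth_largest_mem:
  assumes "1 \<le> j" "j \<le> n"
  shows "nth_largest n j v \<in> v ` {1..n}"
proof -
  have "nth_largest n j v \<in> set (rev (sort (map v [1..<Suc n])))"
    unfolding nth_largest_def using assms by (intro nth_mem) (auto simp del: upt_Suc)
  then show ?thesis
    by (auto simp del: upt_Suc)
qed

text \<open>Every \<open>t\<close> below \<open>v p\<close> is exceeded by \<open>v p\<close> and by
  the \<open>j - 1\<close> values above it, hence by \<open>j\<close> values; density of the order
  gives one inequality. The other holds since \<open>v p\<close> itself is exceeded only
  \<open>j - 1\<close> times.\<close>

lemma nth_largest_eqI:
  assumes j: "1 \<le> j" and p: "p \<in> {1..n}"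
    and card: "card {i\<in>{1..n}. v p < v i} = j - 1"
  shows "nth_largest n j v = v p"
proof -
  have jn: "j \<le> n"
  proof -
    have "card {i\<in>{1..n}. v p < v i} < card {1..n}"
    proof (rule psubset_card_mono)
      show "{i\<in>{1..n}. v p < v i} \<subset> {1..n}"
        using p by blast
    qed simp
    then show ?thesis
      using card j by simp
  qed
  have "t < nth_largest n j v" if t: "t < v p" for t
  proof -
    have "card (insert p {i\<in>{1..n}. v p < v i}) \<le> card {i\<in>{1..n}. t < v i}"
      using t p by (intro card_mono) auto
    then show ?thesis
      using card j jn by (subst nth_largest_gt_iff) auto
  qed
  then have "v p \<le> nth_largest n j v"
    by (meson dense not_less order_less_asym)
  moreover have "\<not> v p < nth_largest n j v"
    using j jn card by (subst nth_largest_gt_iff) auto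
  ultimately show ?thesis
    by simp
qed

text \<open>The converse of \<open>nth_largest_eqI\<close>, where a tie at \<open>v p\<close> would
  spoil the count. A threshold just below \<open>v p\<close> is exceeded at least \<open>j\<close>
  times, and lowering the threshold from \<open>v p\<close> to it adds only the index
  \<open>p\<close>.\<close>

lemma card_above_nth_largest:
  assumes j: "1 \<le> j" "j \<le> n" and inj: "inj_on v {1..n}"
    and p: "p \<in> {1..n}" "v p = nth_largest n j v"
  shows "card {i\<in>{1..n}. v p < v i} = j - 1"
proof -
  have "\<not> j \<le> card {i\<in>{1..n}. v p < v i}"
    using nth_largest_gt_iff[OF j, of "v p" v] p by simp
  moreover have "j - 1 \<le> card {i\<in>{1..n}. v p < v i}"
  proof -
    \<comment> \<open>\<open>Max L\<close> lies below \<open>v p\<close> with no coordinate strictly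
      between them. The extra element \<open>v p - 1\<close> keeps \<open>L\<close> nonempty when
      \<open>v p\<close> is the smallest value.\<close>
    define L where "L = insert (v p - 1) (v ` {i\<in>{1..n}. v i < v p})"
    have L: "finite L" "L \<noteq> {}"
      by (auto simp: L_def)
    have "Max L < v p"
      using L by (subst Max_less_iff) (auto simp: L_def)
    then have "j \<le> card {i\<in>{1..n}. Max L < v i}"
      using nth_largest_gt_iff[OF j, of "Max L" v] p by simp
    also have "{i\<in>{1..n}. Max L < v i} \<subseteq> insert p {i\<in>{1..n}. v p < v i}"
    proof
      fix i assume i: "i \<in> {i\<in>{1..n}. Max L < v i}"
      then have "\<not> v i < v p"
        using L Max_ge[of L "v i"] by (auto simp: L_def)
      then have "v i = v p \<or> v p < v i"
        by auto
      then show "i \<in> insert p {i\<in>{1..n}. v p < v i}"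
        using i p(1) inj_onD[OF inj, of i p] by blast
    qed
    then have "card {i\<in>{1..n}. Max L < v i} \<le> card (insert p {i\<in>{1..n}. v p < v i})"
      by (rule card_mono[rotated]) auto
    also have "\<dots> = Suc (card {i\<in>{1..n}. v p < v i})"
      by simp
    finally show ?thesis
      by simp
  qed
  ultimately show ?thesis
    by simp
qed

text \<open>By the counting criterion a superlevel set says that a finite sum of measurable
  indicators is at least \<open>j\<close>.\<close>

lemma borel_measurable_nth_largest:
  assumes j: "1 \<le> j" "j \<le> n"
    and [measurable]: "\<And>i. i \<in> {1..n} \<Longrightarrow> (\<lambda>\<omega>. V \<omega> i) \<in> borel_measurable N"
  shows "(\<lambda>\<omega>. nth_largest n j (V \<omega>)) \<in> borel_measurable N"
proof (subst borel_measurable_iff_greater, intro allI)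
  fix t
  have card: "real (card {i\<in>{1..n}. t < V \<omega> i}) = (\<Sum>i\<in>{1..n}. indicator {t<..} (V \<omega> i))" for \<omega>
  proof -
    have "(\<Sum>i\<in>{1..n}. indicator {t<..} (V \<omega> i) :: real) = (\<Sum>i\<in>{i\<in>{1..n}. t < V \<omega> i}. 1)"
      by (intro sum.mono_neutral_cong_right) (auto simp: indicator_def)
    then show ?thesis
      by simp
  qed
  have "{\<omega> \<in> space N. t < nth_largest n j (V \<omega>)} =
      {\<omega> \<in> space N. real j \<le> (\<Sum>i\<in>{1..n}. indicator {t<..} (V \<omega> i))}"
    unfolding nth_largest_gt_iff[OF j] card[symmetric] of_nat_le_iff ..
  also have "\<dots> \<in> sets N"
    by measurable
  finally show "{\<omega> \<in> space N. t < nth_largest n j (V \<omega>)} \<in> sets N" .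
qed

text \<open>
  Here \<open>p\<close> and \<open>q\<close> are the indices of the \<open>j\<close>-th and the \<open>k\<close>-th largest value, \<open>S\<close> collects the indices
  of larger values and \<open>T\<close> those strictly in between.
\<close>

definition rank_pattern ::
    "nat \<Rightarrow> (nat \<Rightarrow> real) \<Rightarrow> nat \<Rightarrow> nat \<Rightarrow> nat set \<Rightarrow> nat set \<Rightarrow> bool" where
  "rank_pattern n v p q S T \<longleftrightarrow> v q < v p \<and>
     (\<forall>i\<in>{1..n} - {p, q}. v i \<in> (if i \<in> S then {v p<..} else if i \<in> T then {v q<..<v p} else {..<v q}))"

text \<open>Written as nested dependent sums so that the labels can be counted one choice at a time:
  first \<open>p\<close>, then \<open>q\<close>, then \<open>S\<close>, then
  \<open>T\<close>.\<close>

definition rank_labels :: "nat \<Rightarrow> nat \<Rightarrow> nat \<Rightarrow> (nat \<times> nat \<times> nat set \<times> nat set) set" where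
  "rank_labels n j k = (SIGMA p:{1..n}. SIGMA q:{1..n} - {p}.
     SIGMA S:{S. S \<subseteq> {1..n} - {p, q} \<and> card S = j - 1}.
       {T. T \<subseteq> {1..n} - {p, q} - S \<and> card T = k - j - 1})"

lemma rank_labels_iff:
  "(p, q, S, T) \<in> rank_labels n j k \<longleftrightarrow> p \<in> {1..n} \<and> q \<in> {1..n} \<and> p \<noteq> q \<and>
     S \<subseteq> {1..n} - {p, q} \<and> T \<subseteq> {1..n} - {p, q} - S \<and> card S = j - 1 \<and> card T = k - j - 1"
  unfolding rank_labels_def by blast

lemma finite_rank_labels: "finite (rank_labels n j k)"
proof -
  have "rank_labels n j k \<subseteq> {1..n} \<times> {1..n} \<times> Pow {1..n} \<times> Pow {1..n}"
    unfolding rank_labels_def by blast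
  then show ?thesis
    by (rule finite_subset) simp
qed

text \<open>There are \<open>n\<close> choices of \<open>p\<close>, \<open>n - 1\<close> of
  \<open>q\<close>, then two binomial coefficients for \<open>S\<close> and \<open>T\<close>. The
  factorial of \<open>n - 2 - (j - 1)\<close> cancels between them, and \<open>n - k\<close> indices
  are left over for the values below.\<close>

lemma card_rank_labels:
  assumes "1 \<le> j" "j < k" "k \<le> n"
  shows "real (card (rank_labels n j k)) = fact n / (fact (j - 1) * fact (k - j - 1) * fact (n - k))"
proof -
  have fin: "finite {T. T \<subseteq> A \<and> P T}" if "finite A" for A :: "nat set" and P
    using that by (auto intro: finite_subset[of _ "Pow A"])
  have T: "card {T. T \<subseteq> {1..n} - {p, q} - S \<and> card T = k - j - 1} = (n - 2 - (j - 1)) choose (k - j - 1)"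
    if "p \<in> {1..n}" "q \<in> {1..n} - {p}" "S \<in> {S. S \<subseteq> {1..n} - {p, q} \<and> card S = j - 1}" for p q S
  proof -
    have "card ({1..n} - {p, q}) = n - 2"
      using that by (subst card_Diff_subset) auto
    moreover have "finite S"
      using that by (auto intro: finite_subset)
    ultimately have "card ({1..n} - {p, q} - S) = n - 2 - (j - 1)"
      using that by (subst card_Diff_subset) auto
    then show ?thesis
      by (simp only: n_subsets finite_Diff finite_atLeastAtMost)
  qed
  have S: "card {S. S \<subseteq> {1..n} - {p, q} \<and> card S = j - 1} = (n - 2) choose (j - 1)"
    if "p \<in> {1..n}" "q \<in> {1..n} - {p}" for p q
  proof -
    have "card ({1..n} - {p, q}) = n - 2"
      using that by (subst card_Diff_subset) auto
    then show ?thesis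
      by (simp only: n_subsets finite_Diff finite_atLeastAtMost)
  qed
  have "card (rank_labels n j k) =
      (\<Sum>p\<in>{1..n}. \<Sum>q\<in>{1..n} - {p}. \<Sum>S\<in>{S. S \<subseteq> {1..n} - {p, q} \<and> card S = j - 1}.
         (n - 2 - (j - 1)) choose (k - j - 1))"
    unfolding rank_labels_def
    by (subst card_SigmaI, simp, intro ballI finite_SigmaI fin finite_Diff finite_atLeastAtMost,
        intro sum.cong refl,
        subst card_SigmaI, simp, intro ballI finite_SigmaI fin finite_Diff finite_atLeastAtMost,
        intro sum.cong refl,
        subst card_SigmaI, intro fin finite_Diff finite_atLeastAtMost,
        intro ballI fin finite_Diff finite_atLeastAtMost,
        intro sum.cong refl T)
  also have "\<dots> = (\<Sum>p\<in>{1..n}. \<Sum>q\<in>{1..n} - {p}.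
      ((n - 2) choose (j - 1)) * ((n - 2 - (j - 1)) choose (k - j - 1)))"
    by (intro sum.cong refl) (simp only: sum_constant S of_nat_id)
  also have "\<dots> = n * ((n - 1) * (((n - 2) choose (j - 1)) * ((n - 2 - (j - 1)) choose (k - j - 1))))"
    by simp
  finally have card: "card (rank_labels n j k) =
      n * ((n - 1) * (((n - 2) choose (j - 1)) * ((n - 2 - (j - 1)) choose (k - j - 1))))" .
  \<comment> \<open>\<open>1 \<le> j < k \<le> n\<close> forces \<open>n \<ge> 2\<close>, so the
    factorial of \<open>n\<close> unfolds twice into
    \<open>n * (n - 1) * fact (n - 2)\<close>.\<close>
  obtain m where m: "n = Suc (Suc m)"
    using assms by (intro that[of "n - 2"]) auto
  have "real (card (rank_labels n j k)) =
      real n * real (n - 1) * (fact (n - 2) / (fact (j - 1) * fact (n - 2 - (j - 1)))) *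
      (fact (n - 2 - (j - 1)) / (fact (k - j - 1) * fact (n - k)))"
    unfolding card of_nat_mult using assms by (subst (1 2) binomial_fact) auto
  also have "real n * real (n - 1) * (fact (n - 2) / (fact (j - 1) * fact (n - 2 - (j - 1)))) *
      (fact (n - 2 - (j - 1)) / (fact (k - j - 1) * fact (n - k))) =
      real n * real (n - 1) * fact (n - 2) / (fact (j - 1) * fact (k - j - 1) * fact (n - k))"
    by simp
  also have "real n * real (n - 1) * fact (n - 2) = fact n"
    unfolding m by (simp add: algebra_simps)
  finally show ?thesis .
qed

text \<open>A label can be read off from the vector by comparing coordinates with \<open>v p\<close>
  and \<open>v q\<close>. The singleton level sets say that neither of these two values is attained
  twice.\<close>

lemma rank_pattern_sets:
  assumes "rank_pattern n v p q S T" "(p, q, S, T) \<in> rank_labels n j k"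
  shows "{i\<in>{1..n}. v p < v i} = S"
    and "{i\<in>{1..n}. v q < v i} = insert p (S \<union> T)"
    and "{i\<in>{1..n}. v q < v i \<and> v i < v p} = T"
    and "{i\<in>{1..n}. v i = v p} = {p}"
    and "{i\<in>{1..n}. v i = v q} = {q}"
proof -
  have pq: "p \<in> {1..n}" "q \<in> {1..n}" "S \<subseteq> {1..n} - {p, q}" "T \<subseteq> {1..n} - {p, q} - S"
    using assms(2) unfolding rank_labels_iff by auto
  have lt: "v q < v p"
    using assms(1) by (simp add: rank_pattern_def)
  \<comment> \<open>The five alternatives put \<open>v i\<close> in five different positions
    relative to \<open>v q < v p\<close>, so the position of \<open>v i\<close> determines the class
    of \<open>i\<close>.\<close>
  have cases: "i = p \<or> i = q \<or> (i \<in> S \<and> v p < v i) \<or> (i \<in> T \<and> i \<notin> S \<and> v q < v i \<and> v i < v p) \<or>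
      (i \<notin> S \<and> i \<notin> T \<and> v i < v q)" if "i \<in> {1..n}" for i
  proof (cases "i \<in> {p, q}")
    case False
    then have "v i \<in> (if i \<in> S then {v p<..} else if i \<in> T then {v q<..<v p} else {..<v q})"
      using assms(1) that by (simp add: rank_pattern_def)
    then show ?thesis
      by (auto split: if_splits)
  qed auto
  have notin: "p \<notin> S" "p \<notin> T" "q \<notin> S" "q \<notin> T" "\<And>i. i \<in> S \<Longrightarrow> i \<notin> T"
    using pq by blast+
  have iff: "(v p < v i \<longleftrightarrow> i \<in> S) \<and> (v q < v i \<longleftrightarrow> i \<in> insert p (S \<union> T)) \<and>
      (v q < v i \<and> v i < v p \<longleftrightarrow> i \<in> T) \<and> (v i = v p \<longleftrightarrow> i = p) \<and> (v i = v q \<longleftrightarrow> i = q)"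
    if "i \<in> {1..n}" for i
    using cases[OF that] by (elim disjE conjE) (use lt notin in auto)
  have sub: "S \<subseteq> {1..n}" "T \<subseteq> {1..n}"
    using pq by blast+
  show "{i\<in>{1..n}. v p < v i} = S" "{i\<in>{1..n}. v q < v i} = insert p (S \<union> T)"
    "{i\<in>{1..n}. v q < v i \<and> v i < v p} = T" "{i\<in>{1..n}. v i = v p} = {p}" "{i\<in>{1..n}. v i = v q} = {q}"
    using iff sub pq(1,2) by blast+
qed

text \<open>Exactly the \<open>j - 1\<close> indices in \<open>S\<close> lie above
  \<open>v p\<close>. Above \<open>v q\<close> lie \<open>p\<close>, \<open>S\<close> and
  \<open>T\<close>, which makes \<open>1 + (j - 1) + (k - j - 1) = k - 1\<close> indices.\<close>

lemma rank_pattern_nth_largest: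
  assumes "rank_pattern n v p q S T" "(p, q, S, T) \<in> rank_labels n j k" "1 \<le> j" "j < k"
  shows "nth_largest n j v = v p" "nth_largest n k v = v q"
proof -
  note L = assms(2)[unfolded rank_labels_iff]
  have fin: "finite S" "finite T"
    using L by (auto intro: finite_subset)
  show "nth_largest n j v = v p"
    using L assms(3) by (intro nth_largest_eqI) (auto simp only: rank_pattern_sets[OF assms(1,2)])
  have "p \<notin> S \<union> T" "S \<inter> T = {}"
    using L by auto
  then have "card (insert p (S \<union> T)) = k - 1"
    using L fin assms(3,4) by (simp add: card_Un_disjoint)
  then show "nth_largest n k v = v q"
    using L assms(3,4) by (intro nth_largest_eqI) (auto simp only: rank_pattern_sets[OF assms(1,2)])
qed

text \<open>Both labels give the same two order statistics, and these two values already determine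
  the level sets from which all four components are recovered.\<close>

lemma rank_pattern_unique:
  assumes "rank_pattern n v p q S T" "(p, q, S, T) \<in> rank_labels n j k"
    and "rank_pattern n v p' q' S' T'" "(p', q', S', T') \<in> rank_labels n j k"
    and "1 \<le> j" "j < k"
  shows "(p, q, S, T) = (p', q', S', T')"
proof -
  have v: "v p = v p'" "v q = v q'"
    using rank_pattern_nth_largest[OF assms(1,2,5,6)] rank_pattern_nth_largest[OF assms(3,4,5,6)]
    by simp_all
  then have "S = S'" "T = T'" "{p} = {p'}" "{q} = {q'}"
    using rank_pattern_sets[OF assms(1,2)] rank_pattern_sets[OF assms(3,4)] by metis+
  then show ?thesis
    by simp
qed

lemma rank_pattern_exists:
  assumes inj: "inj_on v {1..n}" and jk: "1 \<le> j" "j < k" "k \<le> n"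
  shows "\<exists>(p, q, S, T)\<in>rank_labels n j k. rank_pattern n v p q S T"
proof -
  obtain p where p: "p \<in> {1..n}" "v p = nth_largest n j v"
    using nth_largest_mem[of j n v] jk by auto
  obtain q where q: "q \<in> {1..n}" "v q = nth_largest n k v"
    using nth_largest_mem[of k n v] jk by auto
  define S where "S = {i\<in>{1..n}. v p < v i}"
  define T where "T = {i\<in>{1..n}. v q < v i \<and> v i < v p}"
  have S: "card S = j - 1"
    unfolding S_def using jk inj p by (intro card_above_nth_largest) auto
  have Q: "card {i\<in>{1..n}. v q < v i} = k - 1"
    using jk inj q by (intro card_above_nth_largest) auto
  \<comment> \<open>Otherwise the \<open>k - 1\<close> indices above \<open>v q\<close> would be
    among the \<open>j - 1\<close> indices above \<open>v p\<close>.\<close>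
  have lt: "v q < v p"
  proof (rule ccontr)
    assume "\<not> v q < v p"
    then have "{i\<in>{1..n}. v q < v i} \<subseteq> S"
      by (auto simp: S_def)
    then have "k - 1 \<le> j - 1"
      unfolding S[symmetric] Q[symmetric] by (intro card_mono) (auto simp: S_def)
    with jk show False
      by simp
  qed
  have eqI: "i = i'" if "v i = v i'" "i \<in> {1..n}" "i' \<in> {1..n}" for i i'
    using inj_onD[OF inj that] .
  have "{i\<in>{1..n}. v q < v i} = insert p (S \<union> T)"
  proof -
    have "i = p \<or> v i < v p \<or> v p < v i" if "i \<in> {1..n}" for i
      using eqI[OF _ that p(1)] by linarith
    then show ?thesis
      using lt p(1) order.strict_trans[OF lt] unfolding S_def T_def by blast
  qed
  moreover have fin: "finite S" "finite T" "p \<notin> S \<union> T" "S \<inter> T = {}"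
    by (auto simp: S_def T_def)
  \<comment> \<open>Solved from \<open>k - 1 = 1 + (j - 1) + card T\<close>, the count of the
    indices above \<open>v q\<close>.\<close>
  ultimately have T: "card T = k - j - 1"
    using Q S jk by (simp add: card_Un_disjoint)
  have "rank_pattern n v p q S T"
    unfolding rank_pattern_def
  proof (intro conjI lt ballI)
    fix i assume i: "i \<in> {1..n} - {p, q}"
    then have "v i \<noteq> v p" "v i \<noteq> v q"
      using eqI p q by blast+
    then show "v i \<in> (if i \<in> S then {v p<..} else if i \<in> T then {v q<..<v p} else {..<v q})"
      using i by (auto simp: S_def T_def)
  qed
  moreover have "(p, q, S, T) \<in> rank_labels n j k"
    unfolding rank_labels_iff using p q lt S T by (auto simp: S_def T_def)
  ultimately show ?thesis
    by blast
qed

section \<open>Order statistics of independent samples from an atomless law\<close>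

lemma (in product_sigma_finite) product_nn_integral_insert2:
  assumes I: "finite I" "q \<notin> I" "p \<notin> insert q I"
    and f[measurable]: "f \<in> borel_measurable (Pi\<^sub>M (insert p (insert q I)) M)"
  shows "integral\<^sup>N (Pi\<^sub>M (insert p (insert q I)) M) f =
    (\<integral>\<^sup>+ y. (\<integral>\<^sup>+ z. (\<integral>\<^sup>+ w. f (w(q := z, p := y)) \<partial>Pi\<^sub>M I M) \<partial>M q) \<partial>M p)"
proof (subst product_nn_integral_insert_rev)
  show "finite (insert q I)" "p \<notin> insert q I" "f \<in> borel_measurable (Pi\<^sub>M (insert p (insert q I)) M)"
    using I f by auto
  show "(\<integral>\<^sup>+ y. (\<integral>\<^sup>+ x. f (x(p := y)) \<partial>Pi\<^sub>M (insert q I) M) \<partial>M p) =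
      (\<integral>\<^sup>+ y. (\<integral>\<^sup>+ z. (\<integral>\<^sup>+ w. f (w(q := z, p := y)) \<partial>Pi\<^sub>M I M) \<partial>M q) \<partial>M p)"
  proof (rule nn_integral_cong)
    fix y assume y: "y \<in> space (M p)"
    have "(\<lambda>x. x(p := y)) \<in> Pi\<^sub>M (insert q I) M \<rightarrow>\<^sub>M Pi\<^sub>M (insert p (insert q I)) M"
      using y by (intro measurable_fun_upd[where J="insert q I"]) auto
    then have "(\<lambda>x. f (x(p := y))) \<in> borel_measurable (Pi\<^sub>M (insert q I) M)"
      by measurable
    from product_nn_integral_insert_rev[OF I(1,2) this]
    show "(\<integral>\<^sup>+ x. f (x(p := y)) \<partial>Pi\<^sub>M (insert q I) M) =
        (\<integral>\<^sup>+ z. (\<integral>\<^sup>+ w. f (w(q := z, p := y)) \<partial>Pi\<^sub>M I M) \<partial>M q)" .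
  qed
qed

text \<open>Vanishing point masses serve twice: ties between independent samples become null events,
  and open and half-open intervals get the same measure.\<close>

locale atomless_distribution = real_distribution D for D :: "real measure" +
  assumes emeasure_point: "emeasure D {x} = 0"
begin

sublocale P: product_prob_space "\<lambda>_. D" UNIV
  by standard

text \<open>For a fixed pair of indices, fixing coordinate \<open>p\<close> at \<open>y\<close>
  confines coordinate \<open>q\<close> to the single point \<open>y\<close>, which has mass zero.
  Only finitely many pairs occur.\<close>

lemma AE_inj_on_PiM:
  assumes "finite I"
  shows "AE v in Pi\<^sub>M I (\<lambda>_. D). inj_on v I"
proof -
  have "AE v in Pi\<^sub>M I (\<lambda>_. D). v p \<noteq> v q" if pq: "p \<in> I" "q \<in> I" "p \<noteq> q" for p q
  proof -
    let ?E = "{v \<in> space (Pi\<^sub>M I (\<lambda>_. D)). v p = v q}"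
    define J where "J = I - {p, q}"
    have IJ: "I = insert p (insert q J)" "finite J" "q \<notin> J" "p \<notin> insert q J"
      using pq assms by (auto simp: J_def)
    note pq[measurable]
    have E[measurable]: "?E \<in> sets (Pi\<^sub>M I (\<lambda>_. D))"
      by measurable
    have "emeasure (Pi\<^sub>M I (\<lambda>_. D)) ?E = (\<integral>\<^sup>+v. indicator ?E v \<partial>Pi\<^sub>M I (\<lambda>_. D))"
      by simp
    also have "\<dots> = (\<integral>\<^sup>+y. \<integral>\<^sup>+z. \<integral>\<^sup>+w. indicator ?E (w(q := z, p := y)) \<partial>Pi\<^sub>M J (\<lambda>_. D) \<partial>D \<partial>D)"
      using E IJ(2-) unfolding IJ(1) by (intro P.product_nn_integral_insert2) auto
    also have "\<dots> \<le> (\<integral>\<^sup>+y. \<integral>\<^sup>+z. \<integral>\<^sup>+w. indicator {y} z \<partial>Pi\<^sub>M J (\<lambda>_. D) \<partial>D \<partial>D)"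
      using pq(3) by (intro nn_integral_mono) (auto simp: indicator_def)
    also have "\<dots> = 0"
    proof -
      interpret J: prob_space "Pi\<^sub>M J (\<lambda>_. D)"
        by (intro prob_space_PiM prob_space_axioms)
      have "(\<integral>\<^sup>+w. indicator {y} z \<partial>Pi\<^sub>M J (\<lambda>_. D)) = indicator {y} z" for y z :: real
        by (simp add: J.emeasure_space_1)
      then show ?thesis
        by (simp add: emeasure_point)
    qed
    finally have "emeasure (Pi\<^sub>M I (\<lambda>_. D)) ?E = 0"
      by simp
    then show ?thesis
      by (intro AE_I[of _ _ ?E]) auto
  qed
  then have "AE v in Pi\<^sub>M I (\<lambda>_. D). \<forall>p\<in>I. \<forall>q\<in>I. p \<noteq> q \<longrightarrow> v p \<noteq> v q"
    using assms by (intro AE_finite_allI) auto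
  then show ?thesis
    by eventually_elim (auto simp: inj_on_def)
qed

text \<open>Once coordinates \<open>p\<close> and \<open>q\<close> are fixed at \<open>y\<close> and
  \<open>z\<close>, each other coordinate is confined to its own interval, so the integral over them
  factorises into powers of interval measures. The result involves the label only through the sizes
  of \<open>S\<close> and \<open>T\<close>, hence is the same for all labels.\<close>

lemma emeasure_rank_pattern:
  assumes R[measurable]: "R \<in> sets (borel \<Otimes>\<^sub>M borel)"
    and L: "(p, q, S, T) \<in> rank_labels n j k" and jk: "1 \<le> j" "j < k" "k \<le> n"
  defines "E \<equiv> {v \<in> space (Pi\<^sub>M {1..n} (\<lambda>_. D)). rank_pattern n v p q S T \<and> (v p, v q) \<in> R}"
  shows "E \<in> sets (Pi\<^sub>M {1..n} (\<lambda>_. D))"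
    and "emeasure (Pi\<^sub>M {1..n} (\<lambda>_. D)) E =
      (\<integral>\<^sup>+y. \<integral>\<^sup>+z. indicator R (y, z) * indicator {..<y} z * emeasure D {y<..} ^ (j - 1) *
         emeasure D {z<..<y} ^ (k - j - 1) * emeasure D {..<z} ^ (n - k) \<partial>D \<partial>D)"
proof -
  define J where "J = {1..n} - {p, q}"
  note L' = L[unfolded rank_labels_iff]
  have IJ: "{1..n} = insert p (insert q J)" "finite J" "q \<notin> J" "p \<notin> insert q J"
    using L' by (auto simp: J_def)
  have pq[measurable]: "p \<in> {1..n}" "q \<in> {1..n}"
    using L' by auto
  let ?K = "\<lambda>y z i. if i \<in> S then {y<..} else if i \<in> T then {z<..<y} else {..<z} :: real set"
  have [measurable]: "Measurable.pred (Pi\<^sub>M {1..n} (\<lambda>_. D)) (\<lambda>v. v i \<in> ?K (v p) (v q) i)" if "i \<in> J" for i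
  proof -
    have i[measurable]: "i \<in> {1..n}"
      using that by (simp add: J_def)
    show ?thesis
      by (cases "i \<in> S"; cases "i \<in> T"; simp del: One_nat_def; measurable)
  qed
  have E_eq: "E = {v \<in> space (Pi\<^sub>M {1..n} (\<lambda>_. D)). v q < v p \<and>
      (\<forall>i\<in>J. v i \<in> ?K (v p) (v q) i) \<and> (v p, v q) \<in> R}"
    by (simp add: E_def rank_pattern_def J_def)
  show E[measurable]: "E \<in> sets (Pi\<^sub>M {1..n} (\<lambda>_. D))"
    unfolding E_eq using IJ(2) by measurable
  \<comment> \<open>The indicator becomes a factor in \<open>y\<close> and \<open>z\<close> times a
    product over coordinates, the shape to which the product rule for integrals applies.\<close>
  have ind: "indicator E (w(q := z, p := y)) =
      (indicator R (y, z) * indicator {..<y} z * (\<Prod>i\<in>J. indicator (?K y z i) (w i)) :: ennreal)"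
    if w: "w \<in> space (Pi\<^sub>M J (\<lambda>_. D))" for w y z
  proof -
    let ?w = "w(q := z, p := y)"
    have "?w \<in> space (Pi\<^sub>M {1..n} (\<lambda>_. D))"
      using w unfolding IJ(1) by (auto simp: space_PiM PiE_def extensional_def)
    moreover have "?w p = y" "?w q = z" "\<And>i. i \<in> J \<Longrightarrow> ?w i = w i"
      using IJ by auto
    ultimately have "?w \<in> E \<longleftrightarrow> z < y \<and> (\<forall>i\<in>J. w i \<in> ?K y z i) \<and> (y, z) \<in> R"
      unfolding E_eq by simp
    moreover have "(\<Prod>i\<in>J. indicator (?K y z i) (w i) :: ennreal) = (if \<forall>i\<in>J. w i \<in> ?K y z i then 1 else 0)"
    proof (cases "\<forall>i\<in>J. w i \<in> ?K y z i")
      case True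
      then show ?thesis
        by (auto intro!: prod.neutral simp: indicator_def)
    next
      case False
      then obtain i where "i \<in> J" "w i \<notin> ?K y z i"
        by blast
      then show ?thesis
        using False IJ(2) by (auto intro!: prod_zero bexI[of _ i] simp: indicator_def)
    qed
    ultimately show ?thesis
      by (simp only: indicator_def) auto
  qed
  have fin: "finite S" "finite T"
    using L' by (auto intro: finite_subset)
  have ST: "S \<subseteq> J" "T \<subseteq> J - S"
    using L' by (auto simp: J_def)
  \<comment> \<open>Removing \<open>S\<close> and \<open>T\<close> from the \<open>n - 2\<close>
    remaining indices leaves \<open>n - 2 - (j - 1) - (k - j - 1) = n - k\<close>.\<close>
  have cJ: "card (J - S - T) = n - k"
  proof -
    have "card J = n - 2"
      unfolding J_def using L' by (subst card_Diff_subset) auto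
    then show ?thesis
      using L' jk ST fin by (simp add: card_Diff_subset)
  qed
  have split: "prod g J = prod g S * (prod g T * prod g (J - S - T))" for g :: "nat \<Rightarrow> ennreal"
    using prod.subset_diff[OF ST(1) IJ(2), of g] prod.subset_diff[OF ST(2), of g] IJ(2)
    by (simp add: mult.commute)
  have prod: "(\<Prod>i\<in>J. emeasure D (?K y z i)) =
      emeasure D {y<..} ^ (j - 1) * emeasure D {z<..<y} ^ (k - j - 1) * emeasure D {..<z} ^ (n - k)" for y z
  proof -
    have "(\<Prod>i\<in>J. emeasure D (?K y z i)) =
        (\<Prod>i\<in>S. emeasure D (?K y z i)) * ((\<Prod>i\<in>T. emeasure D (?K y z i)) *
         (\<Prod>i\<in>J - S - T. emeasure D (?K y z i)))"
      by (rule split)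
    also have "(\<Prod>i\<in>S. emeasure D (?K y z i)) = emeasure D {y<..} ^ (j - 1)"
      using L' by simp
    also have "(\<Prod>i\<in>T. emeasure D (?K y z i)) = (\<Prod>i\<in>T. emeasure D {z<..<y})"
      using ST by (intro prod.cong) auto
    also have "\<dots> = emeasure D {z<..<y} ^ (k - j - 1)"
      using L' by simp
    also have "(\<Prod>i\<in>J - S - T. emeasure D (?K y z i)) = emeasure D {..<z} ^ (n - k)"
      using cJ by simp
    finally show ?thesis
      by (simp add: mult.assoc)
  qed
  have "emeasure (Pi\<^sub>M {1..n} (\<lambda>_. D)) E = (\<integral>\<^sup>+v. indicator E v \<partial>Pi\<^sub>M {1..n} (\<lambda>_. D))"
    by (rule nn_integral_indicator[OF E, symmetric])
  also have "\<dots> = (\<integral>\<^sup>+y. \<integral>\<^sup>+z. \<integral>\<^sup>+w. indicator E (w(q := z, p := y)) \<partial>Pi\<^sub>M J (\<lambda>_. D) \<partial>D \<partial>D)"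
    using E IJ(2-) unfolding IJ(1) by (intro P.product_nn_integral_insert2) auto
  also have "\<dots> = (\<integral>\<^sup>+y. \<integral>\<^sup>+z. \<integral>\<^sup>+w. indicator R (y, z) * indicator {..<y} z *
      (\<Prod>i\<in>J. indicator (?K y z i) (w i)) \<partial>Pi\<^sub>M J (\<lambda>_. D) \<partial>D \<partial>D)"
    by (intro nn_integral_cong ind)
  also have "\<dots> = (\<integral>\<^sup>+y. \<integral>\<^sup>+z. indicator R (y, z) * indicator {..<y} z *
      (\<Prod>i\<in>J. emeasure D (?K y z i)) \<partial>D \<partial>D)"
  proof (intro nn_integral_cong)
    fix y z
    have [measurable]: "indicator (?K y z i) \<in> borel_measurable D" for i
      by (intro borel_measurable_indicator) auto
    have "(\<lambda>w. \<Prod>i\<in>J. indicator (?K y z i) (w i) :: ennreal) \<in> borel_measurable (Pi\<^sub>M J (\<lambda>_. D))"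
      by (intro borel_measurable_prod_ennreal) measurable
    then have "(\<integral>\<^sup>+w. indicator R (y, z) * indicator {..<y} z *
        (\<Prod>i\<in>J. indicator (?K y z i) (w i)) \<partial>Pi\<^sub>M J (\<lambda>_. D)) =
        indicator R (y, z) * indicator {..<y} z *
        (\<integral>\<^sup>+w. (\<Prod>i\<in>J. indicator (?K y z i) (w i)) \<partial>Pi\<^sub>M J (\<lambda>_. D))"
      by (rule nn_integral_cmult)
    also have "(\<integral>\<^sup>+w. (\<Prod>i\<in>J. indicator (?K y z i) (w i)) \<partial>Pi\<^sub>M J (\<lambda>_. D)) =
        (\<Prod>i\<in>J. \<integral>\<^sup>+u. indicator (?K y z i) u \<partial>D)"
      using IJ(2) by (intro P.product_nn_integral_prod) measurable
    also have "\<dots> = (\<Prod>i\<in>J. emeasure D (?K y z i))"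
      by (intro prod.cong refl nn_integral_indicator) auto
    finally show "(\<integral>\<^sup>+w. indicator R (y, z) * indicator {..<y} z *
        (\<Prod>i\<in>J. indicator (?K y z i) (w i)) \<partial>Pi\<^sub>M J (\<lambda>_. D)) =
        indicator R (y, z) * indicator {..<y} z * (\<Prod>i\<in>J. emeasure D (?K y z i))" .
  qed
  finally show "emeasure (Pi\<^sub>M {1..n} (\<lambda>_. D)) E =
      (\<integral>\<^sup>+y. \<integral>\<^sup>+z. indicator R (y, z) * indicator {..<y} z * emeasure D {y<..} ^ (j - 1) *
         emeasure D {z<..<y} ^ (k - j - 1) * emeasure D {..<z} ^ (n - k) \<partial>D \<partial>D)"
    by (simp only: prod mult.assoc)
qed

text \<open>Up to ties, the event is the disjoint union over all labels of events of equal measure,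
  so the number of labels comes out as a factor.\<close>

lemma emeasure_order_statistics:
  assumes R[measurable]: "R \<in> sets (borel \<Otimes>\<^sub>M borel)" and jk: "1 \<le> j" "j < k" "k \<le> n"
  shows "emeasure (Pi\<^sub>M {1..n} (\<lambda>_. D))
      {v \<in> space (Pi\<^sub>M {1..n} (\<lambda>_. D)). (nth_largest n j v, nth_largest n k v) \<in> R} =
    ennreal (fact n / (fact (j - 1) * fact (k - j - 1) * fact (n - k))) *
    (\<integral>\<^sup>+y. \<integral>\<^sup>+z. indicator R (y, z) * indicator {..<y} z * emeasure D {y<..} ^ (j - 1) *
       emeasure D {z<..<y} ^ (k - j - 1) * emeasure D {..<z} ^ (n - k) \<partial>D \<partial>D)"
    (is "emeasure ?P ?A = ennreal ?c * ?I")
proof -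
  define E where "E = (\<lambda>(p, q, S, T). {v \<in> space ?P. rank_pattern n v p q S T \<and> (v p, v q) \<in> R})"
  have meas: "E l \<in> sets ?P" "emeasure ?P (E l) = ?I" if "l \<in> rank_labels n j k" for l
  proof -
    obtain p q S T where l: "l = (p, q, S, T)"
      by (cases l)
    show "E l \<in> sets ?P" "emeasure ?P (E l) = ?I"
      using emeasure_rank_pattern[OF R that[unfolded l] jk] by (simp_all add: l E_def)
  qed
  \<comment> \<open>A vector carries at most one label.\<close>
  have disj: "disjoint_family_on E (rank_labels n j k)"
  proof (unfold disjoint_family_on_def, intro ballI impI)
    fix l l' assume l: "l \<in> rank_labels n j k" "l' \<in> rank_labels n j k" "l \<noteq> l'"
    obtain p q S T p' q' S' T' where "l = (p, q, S, T)" "l' = (p', q', S', T')"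
      by (metis prod_cases4)
    then show "E l \<inter> E l' = {}"
      using l rank_pattern_unique[of n _ p q S T j k p' q' S' T'] jk(1,2) unfolding E_def by blast
  qed
  have union: "v \<in> ?A \<longleftrightarrow> v \<in> (\<Union>l\<in>rank_labels n j k. E l)"
    if v: "v \<in> space ?P" and inj: "inj_on v {1..n}" for v
  proof -
    obtain p q S T where l: "(p, q, S, T) \<in> rank_labels n j k" "rank_pattern n v p q S T"
      using rank_pattern_exists[OF inj jk] by blast
    show ?thesis
    proof
      assume "v \<in> ?A"
      then have "v \<in> E (p, q, S, T)"
        using l v rank_pattern_nth_largest[OF l(2,1) jk(1,2)] by (simp add: E_def)
      with l show "v \<in> (\<Union>l\<in>rank_labels n j k. E l)"
        by blast
    next
      assume "v \<in> (\<Union>l\<in>rank_labels n j k. E l)"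
      then obtain p q S T where "(p, q, S, T) \<in> rank_labels n j k" "rank_pattern n v p q S T" "(v p, v q) \<in> R"
        by (auto simp: E_def)
      then show "v \<in> ?A"
        using v rank_pattern_nth_largest[of n v p q S T j k] jk by simp
    qed
  qed
  have [measurable]: "(\<lambda>v. nth_largest n j v) \<in> borel_measurable ?P" "(\<lambda>v. nth_largest n k v) \<in> borel_measurable ?P"
    using jk by (auto intro!: borel_measurable_nth_largest)
  \<comment> \<open>Existence of a label is guaranteed only for injective vectors, so the two events
    are compared almost everywhere.\<close>
  have "emeasure ?P ?A = emeasure ?P (\<Union>l\<in>rank_labels n j k. E l)"
  proof (rule emeasure_eq_AE)
    show "AE v in ?P. v \<in> ?A \<longleftrightarrow> v \<in> (\<Union>l\<in>rank_labels n j k. E l)"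
      using AE_inj_on_PiM[OF finite_atLeastAtMost] AE_space[of ?P] by eventually_elim (rule union)
    show "?A \<in> sets ?P"
      by measurable
    show "(\<Union>l\<in>rank_labels n j k. E l) \<in> sets ?P"
      using meas finite_rank_labels by (intro sets.finite_UN) auto
  qed
  also have "\<dots> = (\<Sum>l\<in>rank_labels n j k. emeasure ?P (E l))"
    using meas disj finite_rank_labels by (intro sum_emeasure[symmetric]) auto
  also have "\<dots> = of_nat (card (rank_labels n j k)) * ?I"
    using meas by simp
  also have "of_nat (card (rank_labels n j k)) = ennreal (real (card (rank_labels n j k)))"
    by (simp add: ennreal_of_nat_eq_real_of_nat)
  finally show ?thesis
    unfolding card_rank_labels[OF jk] .
qed

end

section \<open>The joint law expressed by the distribution function and a density\<close>

context atomless_distribution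
begin

lemma emeasure_greaterThan_cdf: "emeasure D {y<..} = ennreal (1 - cdf D y)"
proof -
  have "measure D (space D - {..y}) = 1 - measure D {..y}"
    by (rule prob_compl) simp
  moreover have "space D - {..y} = {y<..}"
    by auto
  ultimately show ?thesis
    by (simp add: emeasure_eq_measure cdf_def)
qed

lemma emeasure_lessThan_cdf: "emeasure D {..<z} = ennreal (cdf D z)"
proof -
  have "emeasure D ({..<z} \<union> {z}) = emeasure D {..<z}"
    by (rule emeasure_Un_null_set) (auto simp: null_sets_def emeasure_point)
  moreover have "{..<z} \<union> {z} = {..z}"
    by auto
  ultimately show ?thesis
    by (simp add: emeasure_eq_measure cdf_def)
qed

lemma emeasure_greaterThanLessThan_cdf:
  assumes "z < y"
  shows "emeasure D {z<..<y} = ennreal (cdf D y - cdf D z)"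
proof -
  have "emeasure D ({z<..<y} \<union> {y}) = emeasure D {z<..<y}"
    by (rule emeasure_Un_null_set) (auto simp: null_sets_def emeasure_point)
  moreover have "{z<..<y} \<union> {y} = {z<..y}"
    using assms by auto
  ultimately show ?thesis
    using cdf_diff_eq[OF assms] by (simp add: emeasure_eq_measure)
qed

lemma borel_measurable_cdf[measurable]: "cdf D \<in> borel_measurable borel"
  by (intro borel_measurable_mono monoI cdf_nondecreasing)

end

lemma borel_measurable_order_stat_density[measurable (raw)]:
  assumes [measurable]: "F \<in> borel_measurable borel" "f \<in> borel_measurable borel"
    "g \<in> borel_measurable N" "h \<in> borel_measurable N"
  shows "(\<lambda>w. order_stat_density n j k F f (g w) (h w)) \<in> borel_measurable N"
  unfolding order_stat_density_def by measurable

lemma atomless_distribution_density: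
  assumes [measurable]: "\<phi> \<in> borel_measurable borel"
    and "prob_space (density lborel \<phi>)"
  shows "atomless_distribution (density lborel \<phi>)"
proof -
  interpret prob_space "density lborel \<phi>"
    by fact
  show ?thesis
    by unfold_locales (auto simp: emeasure_density)
qed

text \<open>The three powers are powers of probabilities, hence at most 1. The resulting product
  bound makes the integral over \<open>y\<close> finite for each \<open>z\<close>.\<close>

lemma order_stat_density_le:
  assumes "real_distribution D" "z \<le> y" "\<And>u. 0 \<le> \<phi> u"
  shows "0 \<le> order_stat_density n j k (cdf D) \<phi> y z"
    and "order_stat_density n j k (cdf D) \<phi> y z \<le>
      fact n / (fact (j - 1) * fact (k - j - 1) * fact (n - k)) * \<phi> z * \<phi> y"
proof -
  interpret real_distribution D
    by fact
  let ?c = "fact n / (fact (j - 1) * fact (k - j - 1) * fact (n - k)) :: real"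
  have cdf: "0 \<le> cdf D y" "cdf D y \<le> 1" "0 \<le> cdf D z" "cdf D z \<le> 1" "cdf D z \<le> cdf D y"
    using cdf_nonneg cdf_bounded_prob cdf_nondecreasing[OF assms(2)] by auto
  have eq: "order_stat_density n j k (cdf D) \<phi> y z = ?c * \<phi> z * \<phi> y *
      ((1 - cdf D y) ^ (j - 1) * (cdf D y - cdf D z) ^ (k - j - 1) * cdf D z ^ (n - k))"
    by (simp add: order_stat_density_def mult_ac)
  show "0 \<le> order_stat_density n j k (cdf D) \<phi> y z"
    unfolding eq using cdf assms(3) by (intro mult_nonneg_nonneg zero_le_power) auto
  have "(1 - cdf D y) ^ (j - 1) * (cdf D y - cdf D z) ^ (k - j - 1) * cdf D z ^ (n - k) \<le> 1 * 1 * 1"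
    using cdf by (intro mult_mono power_le_one mult_nonneg_nonneg zero_le_power) auto
  then show "order_stat_density n j k (cdf D) \<phi> y z \<le> ?c * \<phi> z * \<phi> y"
    unfolding eq using assms(3) by (intro mult_left_le) auto
qed

text \<open>The computation runs in nonnegative integrals, where the order of integration can be
  exchanged freely, and passes to Lebesgue integrals only at the end. Positivity of the samples
  enters through \<open>\<phi>\<close> vanishing on nonpositive arguments.\<close>

lemma measure_order_statistics_ratio:
  fixes \<phi> :: "real \<Rightarrow> real"
  assumes [measurable]: "\<phi> \<in> borel_measurable borel"
    and \<phi>: "\<And>u. 0 \<le> \<phi> u" "\<And>u. u \<le> 0 \<Longrightarrow> \<phi> u = 0" and D: "prob_space D" "D = density lborel \<phi>"
    and jk: "1 \<le> j" "j < k" "k \<le> n" and s: "0 < s" and x: "0 < x" "x < 1"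
  shows "measure (Pi\<^sub>M {1..n} (\<lambda>_. D))
      {v \<in> space (Pi\<^sub>M {1..n} (\<lambda>_. D)). nth_largest n k v / (nth_largest n j v + s) \<le> x \<and>
         nth_largest n j v / (nth_largest n k v + s) \<le> x} =
    (LBINT z=0..s * x / (1 - x). (LBINT y=max z ((z - s * x) / x)..x * (z + s).
       order_stat_density n j k (cdf D) \<phi> y z))"
proof -
  interpret atomless_distribution D
    using atomless_distribution_density D by simp
  let ?P = "Pi\<^sub>M {1..n} (\<lambda>_. D)"
  let ?c = "fact n / (fact (j - 1) * fact (k - j - 1) * fact (n - k)) :: real"
  let ?d = "order_stat_density n j k (cdf D) \<phi>"
  let ?b = "s * x / (1 - x)"
  have b: "0 < ?b"
    using s x by simp
  have d_nonneg: "0 \<le> ?d y z" if "z \<le> y" for y z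
    using real_distribution_axioms that \<phi>(1) by (rule order_stat_density_le)
  define R where "R = {p :: real \<times> real. snd p / (fst p + s) \<le> x \<and> fst p / (snd p + s) \<le> x}"
  have R[measurable]: "R \<in> sets (borel \<Otimes>\<^sub>M borel)"
  proof -
    have "{p \<in> space (borel \<Otimes>\<^sub>M borel). snd p / (fst p + s) \<le> x \<and> fst p / (snd p + s) \<le> x} \<in>
        sets (borel \<Otimes>\<^sub>M borel)"
      by measurable
    then show ?thesis
      by (simp add: R_def space_pair_measure)
  qed
  \<comment> \<open>The inner integral in nonnegative form, with the lower limit already simplified
    to \<open>z\<close>.\<close>
  define G where "G z = (\<integral>\<^sup>+y. indicator {z<..<x * (z + s)} y * ennreal (?d y z) \<partial>lborel)" for z
  have inner: "indicator {0<..<?b} z *\<^sub>R (LBINT y=max z ((z - s * x) / x)..x * (z + s). ?d y z) =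
      indicator {0<..<?b} z * enn2real (G z)" for z
  proof (cases "z \<in> {0<..<?b}")
    case True
    then have z: "0 < z" "z * (1 - x) < s * x"
      using x by (auto simp: pos_less_divide_eq)
    \<comment> \<open>Both inequalities rearrange to \<open>z * (1 - x) \<le> s * x\<close>. The
      first makes the maximum equal to \<open>z\<close>; the second puts the limits of integration
      in increasing order.\<close>
    then have "(z - s * x) / x \<le> z" "z \<le> x * (z + s)"
      using x by (auto simp: pos_divide_le_eq algebra_simps)
    then have "(LBINT y=max z ((z - s * x) / x)..x * (z + s). ?d y z) =
        (LBINT y. indicator {z<..<x * (z + s)} y * ?d y z)"
      by (simp add: interval_lebesgue_integral_le_eq max_absorb1 set_lebesgue_integral_def)
    also have "\<dots> = enn2real (\<integral>\<^sup>+y. ennreal (indicator {z<..<x * (z + s)} y * ?d y z) \<partial>lborel)"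
    proof (rule integral_eq_nn_integral)
      show "AE y in lborel. 0 \<le> indicator {z<..<x * (z + s)} y * ?d y z"
        by (auto simp: indicator_def d_nonneg)
    qed simp
    also have "(\<integral>\<^sup>+y. ennreal (indicator {z<..<x * (z + s)} y * ?d y z) \<partial>lborel) = G z"
      unfolding G_def by (intro nn_integral_cong) (auto simp: indicator_def)
    finally show ?thesis
      by simp
  qed simp
  \<comment> \<open>Since \<open>enn2real\<close> sends infinity to 0, finiteness is what allows
    \<open>G z\<close> to be recovered from \<open>enn2real (G z)\<close>.\<close>
  have G_finite: "G z < \<infinity>" for z
  proof -
    have "G z \<le> (\<integral>\<^sup>+y. ennreal (?c * \<phi> z) * ennreal (\<phi> y) \<partial>lborel)"
      unfolding G_def using order_stat_density_le(2)[OF real_distribution_axioms, of z _ \<phi>] \<phi>(1)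
      by (intro nn_integral_mono) (auto simp: indicator_def ennreal_mult'[symmetric] intro!: ennreal_leI)
    also have "\<dots> = ennreal (?c * \<phi> z) * (\<integral>\<^sup>+y. ennreal (\<phi> y) \<partial>lborel)"
      by (rule nn_integral_cmult) simp
    also have "(\<integral>\<^sup>+y. ennreal (\<phi> y) \<partial>lborel) = emeasure D (space D)"
      unfolding D(2) by (simp add: emeasure_density)
    also have "\<dots> = 1"
      by (rule emeasure_space_1)
    finally show ?thesis
      by (simp add: le_less_trans)
  qed
  have [measurable]: "G \<in> borel_measurable borel"
  proof -
    have "G = (\<lambda>z. \<integral>\<^sup>+y. (if z < y \<and> y < x * (z + s) then ennreal (?d y z) else 0) \<partial>lborel)"
      by (auto simp: G_def fun_eq_iff indicator_def intro!: nn_integral_cong)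
    then show ?thesis
      by simp
  qed
  \<comment> \<open>The outage region contains its boundary \<open>y = x * (z + s)\<close> while the
    integration interval is open; this single point is discarded.\<close>
  have AE_eq: "AE y in lborel. ennreal (\<phi> y) * (ennreal (\<phi> z) * (indicator R (y, z) * indicator {..<y} z *
         emeasure D {y<..} ^ (j - 1) * emeasure D {z<..<y} ^ (k - j - 1) * emeasure D {..<z} ^ (n - k))) * ennreal ?c =
      indicator {0<..<?b} z * (indicator {z<..<x * (z + s)} y * ennreal (?d y z))" for z
    using AE_lborel_singleton[of "x * (z + s)"]
  proof eventually_elim
    case (elim y)
    show ?case
    proof (cases "0 < z \<and> z < y")
      case True
      have iff: "(y, z) \<in> R \<longleftrightarrow> y < x * (z + s)"
      proof -
        have "(y, z) \<in> R \<longleftrightarrow> z \<le> x * (y + s) \<and> y \<le> x * (z + s)"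
          using True s by (simp add: R_def pos_divide_le_eq)
        moreover have "z \<le> x * (y + s)" if "y \<le> x * (z + s)"
        proof -
          have "x * (z + s) \<le> x * (y + s)"
            using True x by simp
          then show ?thesis
            using that True by linarith
        qed
        ultimately show ?thesis
          using elim by auto
      qed
      \<comment> \<open>The origin of the outer limit: \<open>z < y < x * (z + s)\<close> is
        possible only for \<open>z * (1 - x) < s * x\<close>.\<close>
      have zb: "z < ?b" if "y < x * (z + s)"
      proof -
        have "z < x * (z + s)"
          using True that by linarith
        then show ?thesis
          using x by (simp add: pos_less_divide_eq algebra_simps)
      qed
      show ?thesis
      proof (cases "y < x * (z + s)")
        case lt: True
        have cdf: "0 \<le> cdf D z" "cdf D z \<le> cdf D y" "cdf D y \<le> 1"
          using cdf_nonneg cdf_bounded_prob cdf_nondecreasing[of z y] True by auto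
        have "ennreal (?d y z) = ennreal (\<phi> y) * (ennreal (\<phi> z) * (emeasure D {y<..} ^ (j - 1) *
            emeasure D {z<..<y} ^ (k - j - 1) * emeasure D {..<z} ^ (n - k))) * ennreal ?c"
          using cdf True \<phi>(1)
          by (simp add: order_stat_density_def emeasure_greaterThan_cdf emeasure_lessThan_cdf
            emeasure_greaterThanLessThan_cdf ennreal_power ennreal_mult'[symmetric] mult_ac)
        then show ?thesis
          using True lt iff zb[OF lt] by (simp add: indicator_def)
      qed (use iff in \<open>simp add: indicator_def\<close>)
    next
      case False
      then consider "z \<le> 0" | "y \<le> z"
        by linarith
      then show ?thesis
        by cases (auto simp: \<phi>(2) indicator_def)
    qed
  qed
  have [measurable]: "(\<lambda>v. nth_largest n j v) \<in> borel_measurable ?P" "(\<lambda>v. nth_largest n k v) \<in> borel_measurable ?P"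
    using jk by (auto intro!: borel_measurable_nth_largest)
  let ?H = "\<lambda>y z. indicator R (y, z) * indicator {..<y} z * emeasure D {y<..} ^ (j - 1) *
       emeasure D {z<..<y} ^ (k - j - 1) * emeasure D {..<z} ^ (n - k) :: ennreal"
  define H where "H = (\<lambda>p. ?H (fst p) (snd p))"
  have [measurable]: "H \<in> borel_measurable (borel \<Otimes>\<^sub>M borel)"
  proof -
    \<comment> \<open>Interval measures are rewritten through \<open>cdf D\<close>, whose
      monotonicity gives joint measurability in both endpoints.\<close>
    have "H = (\<lambda>p. indicator R p * (if snd p < fst p then
        ennreal (1 - cdf D (fst p)) ^ (j - 1) * ennreal (cdf D (fst p) - cdf D (snd p)) ^ (k - j - 1) *
        ennreal (cdf D (snd p)) ^ (n - k) else 0))"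
      by (auto simp: H_def fun_eq_iff indicator_def emeasure_greaterThan_cdf emeasure_lessThan_cdf
            emeasure_greaterThanLessThan_cdf)
    then show ?thesis
      by simp
  qed
  have "emeasure ?P {v \<in> space ?P. nth_largest n k v / (nth_largest n j v + s) \<le> x \<and>
         nth_largest n j v / (nth_largest n k v + s) \<le> x} =
      emeasure ?P {v \<in> space ?P. (nth_largest n j v, nth_largest n k v) \<in> R}"
    by (simp add: R_def)
  also have "\<dots> = ennreal ?c * (\<integral>\<^sup>+y. \<integral>\<^sup>+z. H (y, z) \<partial>D \<partial>D)"
    unfolding H_def fst_conv snd_conv by (rule emeasure_order_statistics[OF R jk])
  also have "(\<integral>\<^sup>+y. \<integral>\<^sup>+z. H (y, z) \<partial>D \<partial>D) =
      (\<integral>\<^sup>+y. ennreal (\<phi> y) * (\<integral>\<^sup>+z. ennreal (\<phi> z) * H (y, z) \<partial>lborel) \<partial>lborel)"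
    unfolding D(2) by (simp add: nn_integral_density)
  also have "\<dots> = (\<integral>\<^sup>+y. \<integral>\<^sup>+z. ennreal (\<phi> y) * (ennreal (\<phi> z) * H (y, z)) \<partial>lborel \<partial>lborel)"
    by (simp add: nn_integral_cmult)
  \<comment> \<open>The order statistics formula has \<open>y\<close> outermost, whereas the claim
    integrates over \<open>z\<close> last.\<close>
  also have "\<dots> = (\<integral>\<^sup>+z. \<integral>\<^sup>+y. ennreal (\<phi> y) * (ennreal (\<phi> z) * H (y, z)) \<partial>lborel \<partial>lborel)"
    by (rule lborel_pair.Fubini') simp
  also have "ennreal ?c * \<dots> =
      (\<integral>\<^sup>+z. \<integral>\<^sup>+y. ennreal (\<phi> y) * (ennreal (\<phi> z) * H (y, z)) * ennreal ?c \<partial>lborel \<partial>lborel)"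
    by (subst mult.commute) (simp add: nn_integral_multc)
  also have "\<dots> = (\<integral>\<^sup>+z. \<integral>\<^sup>+y. indicator {0<..<?b} z * (indicator {z<..<x * (z + s)} y * ennreal (?d y z)) \<partial>lborel \<partial>lborel)"
    unfolding H_def fst_conv snd_conv by (intro nn_integral_cong nn_integral_cong_AE AE_eq)
  also have "\<dots> = (\<integral>\<^sup>+z. indicator {0<..<?b} z * G z \<partial>lborel)"
    unfolding G_def by (intro nn_integral_cong nn_integral_cmult) simp
  also have "\<dots> = (\<integral>\<^sup>+z. ennreal (indicator {0<..<?b} z * enn2real (G z)) \<partial>lborel)"
    using G_finite by (intro nn_integral_cong) (auto simp: indicator_def)
  finally have "measure ?P {v \<in> space ?P. nth_largest n k v / (nth_largest n j v + s) \<le> x \<and>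
         nth_largest n j v / (nth_largest n k v + s) \<le> x} =
      enn2real (\<integral>\<^sup>+z. ennreal (indicator {0<..<?b} z * enn2real (G z)) \<partial>lborel)"
    by (simp add: measure_def)
  also have "\<dots> = (LBINT z. indicator {0<..<?b} z * enn2real (G z))"
    by (intro integral_eq_nn_integral[symmetric]) auto
  also have "\<dots> = (LBINT z. indicator {0<..<?b} z *\<^sub>R (LBINT y=max z ((z - s * x) / x)..x * (z + s). ?d y z))"
    by (simp only: inner)
  also have "\<dots> = (LBINT z=0..?b. (LBINT y=max z ((z - s * x) / x)..x * (z + s). ?d y z))"
    using b by (simp add: interval_lebesgue_integral_le_eq set_lebesgue_integral_def zero_ereal_def)
  finally show ?thesis .
qed

section \<open>The distribution of the SNR\<close>

lemma set_integrable_exp_neg: "set_integrable lborel {0<..} (\<lambda>g::real. exp (- g))"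
proof -
  have "(\<integral>\<^sup>+g. ennreal (exp (- g)) * indicator {0..} g \<partial>lborel) = 1"
    using nn_intergal_power_times_exp_Ici[of 0] by simp
  then have "integrable lborel (\<lambda>g::real. indicator {0..} g * exp (- g))"
    by (intro integrableI_nn_integral_finite[where x=1])
       (auto simp: indicator_def intro!: nn_integral_cong elim!: trans[rotated])
  then have "set_integrable lborel {0..} (\<lambda>g::real. exp (- g))"
    by (simp add: set_integrable_def)
  then show ?thesis
    by (rule set_integrable_subset) auto
qed

text \<open>With \<open>q = sqrt w\<close> and \<open>g = q * exp t\<close> the exponent
  \<open>g + w / g\<close> becomes \<open>2 * q * cosh t\<close>. Folding the line at
  \<open>t = 0\<close> then turns the Jacobian factor \<open>exp t\<close> into
  \<open>2 * cosh t\<close>, as in the definition for order 1.\<close>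

lemma bessel_K_1_conv_integral_exp:
  fixes w :: real
  assumes w: "0 < w"
  shows "set_integrable lborel {0<..} (\<lambda>g. exp (- g - w / g))"
    and "(LBINT g:{0<..}. exp (- g - w / g)) = 2 * sqrt w * bessel_K 1 (2 * sqrt w)"
proof -
  define q where "q = sqrt w"
  have q: "0 < q" "q * q = w"
    using w by (auto simp: q_def)
  \<comment> \<open>The integrand after substitution, including \<open>dg = q * exp t dt\<close>.
    The substitution rule is applied with the inverse map \<open>ln (g / q)\<close>, whose
    derivative is \<open>1 / g\<close>.\<close>
  define f where "f t = q * (exp (- (2 * q * cosh t)) * exp t)" for t :: real
  have [measurable]: "cosh \<in> borel_measurable (borel :: real measure)"
    by (intro borel_measurable_continuous_onI continuous_intros)
  have [measurable]: "f \<in> borel_measurable borel"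
    unfolding f_def by measurable
  show int: "set_integrable lborel {0<..} (\<lambda>g. exp (- g - w / g))"
    using set_integrable_exp_neg
    by (rule set_integrable_bound) (use w in \<open>auto simp: set_borel_measurable_def\<close>)
  have subst: "f (ln (g / q)) * (1 / g) = exp (- g - w / g)" if "0 < g" for g
  proof -
    have "2 * q * cosh (ln (g / q)) = g + w / g"
      using that q by (simp add: cosh_ln_real field_simps flip: q(2))
    then show ?thesis
      using that q by (simp add: f_def)
  qed
  have e: "einterval 0 \<infinity> = {0<..}" "einterval (-\<infinity>) \<infinity> = UNIV"
    by (auto simp: einterval_def)
  have int': "set_integrable lborel (einterval 0 \<infinity>) (\<lambda>g. f (ln (g / q)) * (1 / g))"
    unfolding e using int by (rule set_integrable_cong[THEN iffD1, rotated -1]) (auto simp: subst[simplified])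
  have lim0: "((ereal \<circ> (\<lambda>g. ln (g / q)) \<circ> real_of_ereal) \<longlongrightarrow> -\<infinity>) (at_right 0)"
  proof -
    have "filterlim (\<lambda>g. ln (g / q)) at_bot (at_right 0)"
      using q(1) by real_asymp
    then show ?thesis
      unfolding zero_ereal_def ereal_tendsto_simps .
  qed
  have limI: "((ereal \<circ> (\<lambda>g. ln (g / q)) \<circ> real_of_ereal) \<longlongrightarrow> \<infinity>) (at_left \<infinity>)"
  proof -
    have "filterlim (\<lambda>g. ln (g / q)) at_top at_top"
      using q(1) by real_asymp
    then show ?thesis
      unfolding ereal_tendsto_simps .
  qed
  \<comment> \<open>The rule also yields integrability of \<open>f\<close>, which the splitting at 0
    requires.\<close>
  have "set_integrable lborel (einterval (-\<infinity>) \<infinity>) f"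
    and eq: "(LBINT t=-\<infinity>..\<infinity>. f t) = (LBINT g=0..\<infinity>. f (ln (g / q)) * (1 / g))"
    by (rule interval_integral_substitution_nonneg[where a=0 and b=\<infinity> and g="\<lambda>g. ln (g / q)" and g'="\<lambda>g. 1 / g", OF _ _ _ _ _ _ lim0 limI int'];
      use q in \<open>auto intro!: derivative_eq_intros continuous_intros simp: f_def cosh_def\<close>)+
  then have f: "integrable lborel f"
    by (simp add: e set_integrable_def)
  have f': "integrable lborel (\<lambda>t. f (- t))"
    using lborel_integrable_real_affine[OF f, of "-1" 0] by simp
  have "(LBINT g:{0<..}. exp (- g - w / g)) = (LBINT g:{0<..}. f (ln (g / q)) * (1 / g))"
    by (intro set_lebesgue_integral_cong) (auto simp: subst[simplified])
  also have "\<dots> = (LBINT t. f t)"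
    using eq by (simp add: interval_lebesgue_integral_def e set_lebesgue_integral_def)
  also have "\<dots> = (LBINT t. indicator {0..} t * f t + indicator {..<0} t * f t)"
    by (intro Bochner_Integration.integral_cong) (auto simp: indicator_def)
  also have "\<dots> = (LBINT t. indicator {0..} t * f t) + (LBINT t. indicator {..<0} t * f t)"
    using f by (intro Bochner_Integration.integral_add integrable_mult_indicator[where 'b=real, simplified]) auto
  also have "(LBINT t. indicator {..<0} t * f t) = (LBINT t. indicator {..<0} (- t) * f (- t))"
    using lborel_integral_real_affine[of "-1" "\<lambda>t. indicator {..<0} t * f t" 0] by simp
  also have "\<dots> = (LBINT t. indicator {0..} t * f (- t))"
  proof (rule integral_cong_AE)
    show "AE t in lborel. indicator {..<0} (- t) * f (- t) = indicator {0..} t * f (- t)"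
      using AE_lborel_singleton[of 0] by eventually_elim (auto simp: indicator_def)
  qed simp_all
  also have "(LBINT t. indicator {0..} t * f t) + (LBINT t. indicator {0..} t * f (- t)) =
      (LBINT t. indicator {0..} t * f t + indicator {0..} t * f (- t))"
    using f f' by (intro Bochner_Integration.integral_add[symmetric] integrable_mult_indicator[where 'b=real, simplified]) auto
  also have "\<dots> = (LBINT t. 2 * q * (indicator {0..} t * (exp (- (2 * q * cosh t)) * cosh (1 * t))))"
    by (intro Bochner_Integration.integral_cong) (auto simp: f_def cosh_def algebra_simps)
  also have "\<dots> = 2 * sqrt w * bessel_K 1 (2 * sqrt w)"
    by (simp add: bessel_K_def set_lebesgue_integral_def q_def)
  finally show "(LBINT g:{0<..}. exp (- g - w / g)) = 2 * sqrt w * bessel_K 1 (2 * sqrt w)" .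
qed

lemma has_real_derivative_cdf_density:
  assumes D: "prob_space D" "D = density lborel \<phi>"
    and [measurable]: "\<phi> \<in> borel_measurable borel" and \<phi>: "\<And>t. 0 \<le> \<phi> t"
    and cont: "continuous_on {0<..} \<phi>" and u: "(0::real) < u"
  shows "(cdf D has_real_derivative \<phi> u) (at u)"
proof -
  interpret prob_space D
    by fact
  interpret real_distribution D
    by unfold_locales (simp_all add: D)
  \<comment> \<open>A compact interval inside the positive reals with \<open>u\<close> in its
    interior: \<open>\<phi>\<close> is continuous there, and the fundamental theorem is applied with
    base point \<open>a\<close>.\<close>
  define a where "a = u / 2"
  define b where "b = u + 1"
  have ab: "0 < a" "a < u" "u < b"
    using u by (auto simp: a_def b_def)
  have cont': "continuous_on {a..b} \<phi>"
    using cont by (rule continuous_on_subset) (use ab in auto)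
  have cdf: "cdf D t = cdf D a + integral {a..t} \<phi>" if t: "t \<in> {a..b}" for t
  proof (cases "t = a")
    case False
    have int: "set_integrable lborel {a..t} \<phi>"
      using t by (intro borel_integrable_atLeastAtMost' continuous_on_subset[OF cont']) auto
    have "ennreal (measure D {a<..t}) = emeasure D {a<..t}"
      by (simp add: emeasure_eq_measure)
    also have "\<dots> = (\<integral>\<^sup>+v. ennreal (\<phi> v) * indicator {a<..t} v \<partial>lborel)"
      unfolding D(2) by (simp add: emeasure_density)
    \<comment> \<open>The endpoint \<open>a\<close> is a null set, so the half-open interval may be
      closed.\<close>
    also have "\<dots> = (\<integral>\<^sup>+v. ennreal (indicator {a..t} v * \<phi> v) \<partial>lborel)"
      using AE_lborel_singleton[of a]
      by (intro nn_integral_cong_AE) (auto simp: indicator_def)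
    also have "\<dots> = ennreal (LBINT v:{a..t}. \<phi> v)"
      using int \<phi> by (subst nn_integral_eq_integral) (auto simp: set_integrable_def set_lebesgue_integral_def)
    finally have "measure D {a<..t} = (LBINT v:{a..t}. \<phi> v)"
      using \<phi> by (subst (asm) ennreal_inj)
        (auto simp: set_lebesgue_integral_def intro!: Bochner_Integration.integral_nonneg)
    then have "measure D {a<..t} = integral {a..t} \<phi>"
      using set_borel_integral_eq_integral(2)[OF int] by simp
    then show ?thesis
      using cdf_diff_eq[of a t] False t by auto
  qed simp
  have "((\<lambda>t. cdf D a + integral {a..t} \<phi>) has_real_derivative \<phi> u) (at u within {a..b})"
    using DERIV_add[OF DERIV_const integral_has_real_derivative[OF cont', of u], of "cdf D a"] ab by simp
  then have "(cdf D has_real_derivative \<phi> u) (at u within {a..b})"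
    by (rule has_field_derivative_transform_within[where d=1]) (use ab in \<open>auto simp: cdf[symmetric]\<close>)
  then show ?thesis
    using ab by (simp add: at_within_Icc_at)
qed

text \<open>The density of \<open>H / (A + B / G)\<close> for independent standard exponential \<open>G\<close> and \<open>H\<close>.\<close>

definition exp_mixture_density :: "real \<Rightarrow> real \<Rightarrow> real \<Rightarrow> real" where
  "exp_mixture_density A B u =
     (if 0 < u then LBINT g:{0<..}. exp (- g) * ((A + B / g) * exp (- (u * (A + B / g)))) else 0)"

lemma borel_measurable_exp_mixture_density[measurable]: "exp_mixture_density A B \<in> borel_measurable borel"
  unfolding exp_mixture_density_def[abs_def] set_lebesgue_integral_def by measurable

lemma nn_integral_exp_tail:
  fixes r u :: real
  assumes "0 < r"
  shows "(\<integral>\<^sup>+v. indicator {u<..} v * ennreal (r * exp (- (v * r))) \<partial>lborel) = ennreal (exp (- (u * r)))"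
proof -
  have "(\<integral>\<^sup>+v. ennreal (r * exp (- (v * r))) * indicator {u..} v \<partial>lborel) = ennreal (0 - - exp (- (u * r)))"
  proof (rule nn_integral_FTC_atLeast)
    show "((\<lambda>v. - exp (- (v * r))) \<longlongrightarrow> 0) at_top"
      using assms by real_asymp
  qed (use assms in \<open>auto intro!: derivative_eq_intros\<close>)
  moreover have "(\<integral>\<^sup>+v. indicator {u<..} v * ennreal (r * exp (- (v * r))) \<partial>lborel) =
      (\<integral>\<^sup>+v. ennreal (r * exp (- (v * r))) * indicator {u..} v \<partial>lborel)"
    using AE_lborel_singleton[of u] by (intro nn_integral_cong_AE) (auto simp: indicator_def)
  ultimately show ?thesis
    by simp
qed

section \<open>Continuity and tail of the exponential mixture\<close>

context
  fixes A B :: real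
  assumes AB: "0 < A" "0 < B"
begin

lemma rate_pos: "0 < g \<Longrightarrow> 0 < A + B / g"
  using AB by (simp add: add_pos_pos)

text \<open>With \<open>r\<close> the rate, \<open>v * r \<le> u * r \<le> exp (u * r)\<close>. The
  bound does not involve \<open>u\<close>, so it dominates the integrands for all
  \<open>u \<ge> v\<close> at once.\<close>

lemma exp_mixture_integrand_le:
  assumes "0 < v" "v \<le> u" "0 < g"
  shows "exp (- g) * ((A + B / g) * exp (- (u * (A + B / g)))) \<le> exp (- g) * (1 / v)"
proof -
  let ?r = "A + B / g"
  have r: "0 < ?r"
    using rate_pos assms by simp
  have "v * ?r \<le> u * ?r"
    using r assms by simp
  also have "\<dots> \<le> exp (u * ?r)"
    using exp_ge_add_one_self[of "u * ?r"] by linarith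
  finally have "?r * exp (- (u * ?r)) \<le> 1 / v"
    using assms by (simp add: exp_minus field_simps)
  then show ?thesis
    by (intro mult_left_mono) simp_all
qed

lemma set_integrable_exp_mixture:
  assumes "0 < u"
  shows "set_integrable lborel {0<..} (\<lambda>g. exp (- g) * ((A + B / g) * exp (- (u * (A + B / g)))))"
proof (rule set_integrable_bound)
  show "set_integrable lborel {0<..} (\<lambda>g. exp (- g) * (1 / u))"
    using set_integrable_exp_neg by (rule set_integrable_mult_left)
  show "set_borel_measurable lborel {0<..} (\<lambda>g. exp (- g) * ((A + B / g) * exp (- (u * (A + B / g)))))"
    by (simp add: set_borel_measurable_def)
  show "AE g in lborel. g \<in> {0<..} \<longrightarrow>
      norm (exp (- g) * ((A + B / g) * exp (- (u * (A + B / g))))) \<le> norm (exp (- g) * (1 / u))"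
  proof (intro AE_I2 impI)
    fix g :: real assume "g \<in> {0<..}"
    then show "norm (exp (- g) * ((A + B / g) * exp (- (u * (A + B / g))))) \<le> norm (exp (- g) * (1 / u))"
      using exp_mixture_integrand_le[of u u g] rate_pos[of g] assms by (simp add: abs_mult)
  qed
qed

lemma exp_mixture_density_nonneg: "0 \<le> exp_mixture_density A B u"
  using rate_pos unfolding exp_mixture_density_def set_lebesgue_integral_def
  by (auto intro!: Bochner_Integration.integral_nonneg simp: indicator_def less_imp_le)

lemma continuous_on_exp_mixture_density: "continuous_on {0<..} (exp_mixture_density A B)"
proof (intro continuous_at_imp_continuous_on ballI)
  fix u :: real assume "u \<in> {0<..}"
  then have u: "0 < u"
    by simp
  let ?F = "\<lambda>v g. indicator {0<..} g *\<^sub>R (exp (- g) * ((A + B / g) * exp (- (v * (A + B / g)))))"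
  show "isCont (exp_mixture_density A B) u"
    unfolding continuous_at_sequentially
  proof (intro allI impI)
    fix X assume X: "X \<longlonglongrightarrow> u"
    \<comment> \<open>Truncation at \<open>u / 2\<close> keeps the whole sequence in the range of a
      single majorant; since \<open>X\<close> tends to \<open>u > u / 2\<close>, it changes only
      finitely many terms.\<close>
    define X' where "X' n = max (X n) (u / 2)" for n
    have X': "X' \<longlonglongrightarrow> u"
      using tendsto_max[OF X tendsto_const[of "u / 2"]] u by (simp add: X'_def[abs_def])
    have "(\<lambda>n. LBINT g. ?F (X' n) g) \<longlonglongrightarrow> (LBINT g. ?F u g)"
    proof (rule integral_dominated_convergence[where w="\<lambda>g. indicator {0<..} g *\<^sub>R (exp (- g) * (1 / (u / 2)))"])
      show "integrable lborel (\<lambda>g::real. indicator {0<..} g *\<^sub>R (exp (- g) * (1 / (u / 2))))"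
        using set_integrable_mult_left[OF set_integrable_exp_neg, of "1 / (u / 2)"]
        by (simp only: set_integrable_def)
      show "AE g in lborel. (\<lambda>n. ?F (X' n) g) \<longlonglongrightarrow> ?F u g"
        by (intro AE_I2 tendsto_intros X')
      fix n
      show "AE g in lborel. norm (?F (X' n) g) \<le> indicator {0<..} g *\<^sub>R (exp (- g) * (1 / (u / 2)))"
      proof (intro AE_I2)
        fix g :: real
        show "norm (?F (X' n) g) \<le> indicator {0<..} g *\<^sub>R (exp (- g) * (1 / (u / 2)))"
          using exp_mixture_integrand_le[of "u / 2" "X' n" g] rate_pos[of g] u
          by (auto simp: indicator_def X'_def abs_mult)
      qed
    qed measurable
    moreover have "eventually (\<lambda>n. (LBINT g. ?F (X' n) g) = (exp_mixture_density A B \<circ> X) n) sequentially"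
    proof -
      have "eventually (\<lambda>n. u / 2 < X n) sequentially"
        using X u by (intro order_tendstoD) auto
      then show ?thesis
        by eventually_elim (use u in \<open>simp add: exp_mixture_density_def set_lebesgue_integral_def X'_def max_def\<close>)
    qed
    ultimately show "(exp_mixture_density A B \<circ> X) \<longlonglongrightarrow> exp_mixture_density A B u"
      using u by (simp add: exp_mixture_density_def set_lebesgue_integral_def Lim_transform_eventually)
  qed
qed

lemma ennreal_exp_mixture_density:
  assumes "0 < u"
  shows "ennreal (exp_mixture_density A B u) =
    (\<integral>\<^sup>+g. indicator {0<..} g * ennreal (exp (- g) * ((A + B / g) * exp (- (u * (A + B / g))))) \<partial>lborel)"
proof -
  have "(\<integral>\<^sup>+g. ennreal (indicator {0<..} g *\<^sub>R (exp (- g) * ((A + B / g) * exp (- (u * (A + B / g)))))) \<partial>lborel) =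
      ennreal (LBINT g. indicator {0<..} g *\<^sub>R (exp (- g) * ((A + B / g) * exp (- (u * (A + B / g))))))"
    using set_integrable_exp_mixture[OF assms] rate_pos unfolding set_integrable_def
    by (intro nn_integral_eq_integral) (auto simp: indicator_def less_imp_le)
  then show ?thesis
    using assms by (simp add: exp_mixture_density_def set_lebesgue_integral_def indicator_mult_ennreal)
qed

text \<open>Integrating over \<open>v\<close> before mixing over \<open>g\<close> gives the
  exponential tail \<open>exp (- (u * (A + B / g)))\<close>. Its factor depending on
  \<open>g\<close> joins \<open>exp (- g)\<close> to form the Bessel integral with
  \<open>w = B * u\<close>.\<close>

lemma emeasure_exp_mixture_tail:
  assumes u: "0 < u"
  shows "emeasure (density lborel (\<lambda>u. ennreal (exp_mixture_density A B u))) {u<..} =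
    ennreal (exp (- (u * A)) * (2 * sqrt (B * u) * bessel_K 1 (2 * sqrt (B * u))))"
proof -
  have "emeasure (density lborel (\<lambda>u. ennreal (exp_mixture_density A B u))) {u<..} =
      (\<integral>\<^sup>+v. indicator {u<..} v * ennreal (exp_mixture_density A B v) \<partial>lborel)"
    by (simp add: emeasure_density mult.commute)
  also have "\<dots> = (\<integral>\<^sup>+v. \<integral>\<^sup>+g. indicator {u<..} v * (indicator {0<..} g *
      ennreal (exp (- g) * ((A + B / g) * exp (- (v * (A + B / g)))))) \<partial>lborel \<partial>lborel)"
    using u by (intro nn_integral_cong) (auto simp: indicator_def ennreal_exp_mixture_density)
  also have "\<dots> = (\<integral>\<^sup>+g. \<integral>\<^sup>+v. indicator {u<..} v * (indicator {0<..} g *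
      ennreal (exp (- g) * ((A + B / g) * exp (- (v * (A + B / g)))))) \<partial>lborel \<partial>lborel)"
    by (rule lborel_pair.Fubini') simp
  also have "\<dots> = (\<integral>\<^sup>+g. ennreal (indicator {0<..} g *\<^sub>R (exp (- (u * A)) * exp (- g - B * u / g))) \<partial>lborel)"
  proof (rule nn_integral_cong)
    fix g :: real
    show "(\<integral>\<^sup>+v. indicator {u<..} v * (indicator {0<..} g *
        ennreal (exp (- g) * ((A + B / g) * exp (- (v * (A + B / g)))))) \<partial>lborel) =
        ennreal (indicator {0<..} g *\<^sub>R (exp (- (u * A)) * exp (- g - B * u / g)))"
    proof (cases "0 < g")
      case True
      have "(\<integral>\<^sup>+v. indicator {u<..} v * ennreal (exp (- g) * ((A + B / g) * exp (- (v * (A + B / g))))) \<partial>lborel) =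
          (\<integral>\<^sup>+v. ennreal (exp (- g)) * (indicator {u<..} v * ennreal ((A + B / g) * exp (- (v * (A + B / g))))) \<partial>lborel)"
        by (intro nn_integral_cong) (auto simp: indicator_def ennreal_mult')
      also have "\<dots> = ennreal (exp (- g)) * ennreal (exp (- (u * (A + B / g))))"
        by (subst nn_integral_cmult) (auto simp: nn_integral_exp_tail rate_pos True)
      also have "\<dots> = ennreal (exp (- (u * A)) * exp (- g - B * u / g))"
        by (simp add: ennreal_mult'[symmetric] exp_add[symmetric] algebra_simps)
      finally show ?thesis
        using True by simp
    qed simp
  qed
  also have "\<dots> = ennreal (LBINT g:{0<..}. exp (- (u * A)) * exp (- g - B * u / g))"
    unfolding set_lebesgue_integral_def
    using set_integrable_mult_right[OF bessel_K_1_conv_integral_exp(1)[of "B * u"], of "exp (- (u * A))"] u AB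
    by (intro nn_integral_eq_integral) (auto simp: set_integrable_def)
  also have "(LBINT g:{0<..}. exp (- (u * A)) * exp (- g - B * u / g)) =
      exp (- (u * A)) * (2 * sqrt (B * u) * bessel_K 1 (2 * sqrt (B * u)))"
    using u AB by (simp add: bessel_K_1_conv_integral_exp(2))
  finally show ?thesis .
qed

end

text \<open>Conditionally on \<open>G = g\<close>, scaling a standard exponential variable by the
  inverse of \<open>A + B / g\<close> makes that number the rate. Knowing \<open>W\<close> for
  \<open>g > 0\<close> suffices because \<open>G\<close> is positive almost surely.\<close>

lemma (in prob_space) distributed_exp_mixture:
  assumes AB: "0 < A" "0 < B"
    and G: "distributed M lborel G (exponential_density 1)"
    and H: "distributed M lborel H (exponential_density 1)"
    and ind: "indep_var borel G borel H"
    and W[measurable]: "case_prod W \<in> borel_measurable (borel \<Otimes>\<^sub>M borel)"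
    and W_eq: "\<And>g h. 0 < g \<Longrightarrow> W g h = h / (A + B / g)"
  shows "distributed M lborel (\<lambda>\<omega>. W (G \<omega>) (H \<omega>)) (exp_mixture_density A B)"
proof -
  have [measurable]: "G \<in> borel_measurable M" "H \<in> borel_measurable M"
    using G H by (auto dest: distributed_measurable)
  have G': "distr M borel G = density lborel (\<lambda>u. ennreal (exponential_density 1 u))"
    and H': "distr M borel H = density lborel (\<lambda>u. ennreal (exponential_density 1 u))"
    using distributed_distr_eq_density[OF G] distributed_distr_eq_density[OF H]
    by (simp_all cong: distr_cong)
  let ?E = "density lborel (\<lambda>u. ennreal (exponential_density 1 u))"
  interpret E: prob_space ?E
    by (rule prob_space_exponential_density) simp
  have joint: "distr M (borel \<Otimes>\<^sub>M borel) (\<lambda>\<omega>. (G \<omega>, H \<omega>)) = ?E \<Otimes>\<^sub>M ?E"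
    using ind unfolding indep_var_distribution_eq G' H' by simp
  have "distr M lborel (\<lambda>\<omega>. W (G \<omega>) (H \<omega>)) = density lborel (\<lambda>u. ennreal (exp_mixture_density A B u))"
  proof (rule measure_eqI)
    fix S assume "S \<in> sets (distr M lborel (\<lambda>\<omega>. W (G \<omega>) (H \<omega>)))"
    then have S[measurable]: "S \<in> sets borel"
      by simp
    have "emeasure (distr M lborel (\<lambda>\<omega>. W (G \<omega>) (H \<omega>))) S = (\<integral>\<^sup>+\<omega>. indicator S (W (G \<omega>) (H \<omega>)) \<partial>M)"
    proof -
      have "indicator S \<in> borel_measurable lborel"
        by simp
      then show ?thesis
        by (subst nn_integral_indicator[symmetric], simp, subst nn_integral_distr) simp_all
    qed
    also have "\<dots> = (\<integral>\<^sup>+p. indicator S (case_prod W p) \<partial>distr M (borel \<Otimes>\<^sub>M borel) (\<lambda>\<omega>. (G \<omega>, H \<omega>)))"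
      by (simp add: nn_integral_distr)
    also have "\<dots> = (\<integral>\<^sup>+g. \<integral>\<^sup>+h. indicator S (W g h) \<partial>?E \<partial>?E)"
      unfolding joint by (subst E.nn_integral_fst[symmetric]) simp_all
    also have "\<dots> = (\<integral>\<^sup>+g. ennreal (exponential_density 1 g) *
        (\<integral>\<^sup>+h. ennreal (exponential_density 1 h) * indicator S (W g h) \<partial>lborel) \<partial>lborel)"
      by (simp add: nn_integral_density)
    also have "\<dots> = (\<integral>\<^sup>+g. \<integral>\<^sup>+u. indicator S u * indicator {0<..} u * (indicator {0<..} g *
        ennreal (exp (- g) * ((A + B / g) * exp (- (u * (A + B / g)))))) \<partial>lborel \<partial>lborel)"
    proof (rule nn_integral_cong_AE)
      show "AE g in lborel. ennreal (exponential_density 1 g) *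
          (\<integral>\<^sup>+h. ennreal (exponential_density 1 h) * indicator S (W g h) \<partial>lborel) =
          (\<integral>\<^sup>+u. indicator S u * indicator {0<..} u * (indicator {0<..} g *
            ennreal (exp (- g) * ((A + B / g) * exp (- (u * (A + B / g)))))) \<partial>lborel)"
        \<comment> \<open>\<open>exponential_density 1\<close> equals 1 at 0, where the indicator of
          the open half-line vanishes; the point is removed as a null set.\<close>
        using AE_lborel_singleton[of 0]
      proof eventually_elim
        case (elim g)
        show ?case
        proof (cases "0 < g")
          case True
          let ?r = "A + B / g"
          have r: "0 < ?r"
            using rate_pos[OF AB True] .
          \<comment> \<open>The linear substitution \<open>h = ?r * u\<close> turns
            \<open>W g h\<close> into \<open>u\<close>.\<close>
          have "(\<integral>\<^sup>+h. ennreal (exponential_density 1 h) * indicator S (W g h) \<partial>lborel) =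
              ennreal \<bar>?r\<bar> * (\<integral>\<^sup>+u. ennreal (exponential_density 1 (0 + ?r * u)) * indicator S (W g (0 + ?r * u)) \<partial>lborel)"
            by (rule nn_integral_real_affine) (use r in simp_all)
          also have "\<dots> = (\<integral>\<^sup>+u. ennreal ?r * (ennreal (exponential_density 1 (?r * u)) * indicator S u) \<partial>lborel)"
            using r True by (simp add: nn_integral_cmult W_eq)
          finally have "ennreal (exponential_density 1 g) *
              (\<integral>\<^sup>+h. ennreal (exponential_density 1 h) * indicator S (W g h) \<partial>lborel) =
              (\<integral>\<^sup>+u. ennreal (exp (- g)) * (ennreal ?r * (ennreal (exponential_density 1 (?r * u)) * indicator S u)) \<partial>lborel)"
            using True by (simp add: exponential_density_def nn_integral_cmult)
          also have "\<dots> = (\<integral>\<^sup>+u. indicator S u * indicator {0<..} u *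
            ennreal (exp (- g) * (?r * exp (- (u * ?r)))) \<partial>lborel)"
          proof (rule nn_integral_cong_AE)
            show "AE u in lborel. ennreal (exp (- g)) * (ennreal ?r * (ennreal (exponential_density 1 (?r * u)) * indicator S u)) =
                indicator S u * indicator {0<..} u * ennreal (exp (- g) * (?r * exp (- (u * ?r))))"
              using AE_lborel_singleton[of 0]
            proof eventually_elim
              case (elim u)
              show ?case
              proof (cases "0 < u")
                case True
                then have "exponential_density 1 (?r * u) = exp (- (u * ?r))"
                  using mult_pos_pos[OF r True] by (simp add: exponential_density_def mult.commute)
                then show ?thesis
                  using True r by (simp add: ennreal_mult' mult_ac)
              next
                case False
                then have "?r * u < 0"
                  using elim r by (simp add: mult_pos_neg)
                then show ?thesis
                  using False by (simp add: exponential_density_def)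
              qed
            qed
          qed
          finally show ?thesis
            using True by simp
        next
          case False
          then show ?thesis
            using elim by (simp add: exponential_density_def)
        qed
      qed
    qed
    also have "\<dots> = (\<integral>\<^sup>+u. \<integral>\<^sup>+g. indicator S u * indicator {0<..} u * (indicator {0<..} g *
        ennreal (exp (- g) * ((A + B / g) * exp (- (u * (A + B / g)))))) \<partial>lborel \<partial>lborel)"
      by (rule lborel_pair.Fubini') simp
    also have "\<dots> = (\<integral>\<^sup>+u. ennreal (exp_mixture_density A B u) * indicator S u \<partial>lborel)"
    proof (rule nn_integral_cong)
      fix u :: real
      show "(\<integral>\<^sup>+g. indicator S u * indicator {0<..} u * (indicator {0<..} g *
          ennreal (exp (- g) * ((A + B / g) * exp (- (u * (A + B / g)))))) \<partial>lborel) =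
          ennreal (exp_mixture_density A B u) * indicator S u"
      proof (cases "0 < u")
        case True
        then show ?thesis
          by (subst nn_integral_cmult) (simp_all add: ennreal_exp_mixture_density[OF AB] mult.commute)
      qed (simp add: exp_mixture_density_def)
    qed
    also have "\<dots> = emeasure (density lborel (\<lambda>u. ennreal (exp_mixture_density A B u))) S"
      by (simp add: emeasure_density)
    finally show "emeasure (distr M lborel (\<lambda>\<omega>. W (G \<omega>) (H \<omega>))) S =
        emeasure (density lborel (\<lambda>u. ennreal (exp_mixture_density A B u))) S" .
  qed simp
  then show ?thesis
    by (simp add: distributed_def)
qed

section \<open>From channel gains to independent SNRs with a known law\<close>

lemma snr_conv_exp_mixture:
  fixes Pt s t1 t2 a b c G H :: real
  assumes "0 < Pt" "0 < s" "0 < t1" "0 < t2" "0 < c" "0 < a * c - b" "0 < G"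
  shows "snr Pt s t1 t2 a b c G H =
    H / (s * c * t2 / (t1 * (a * c - b)) + s * c\<^sup>2 * t2 / (Pt * t1 * (a * c - b)) / G)"
proof -
  \<comment> \<open>Subtracting \<open>b / c\<close> cancels the constant term of the numerator, so
    the energy is \<open>t1 * Pt * G * d / (c * (Pt * G + c))\<close>. Its reciprocal is affine in
    \<open>1 / G\<close>, which produces the two summands of the rate.\<close>
  define d where "d = a * c - b"
  have d: "0 < d" "a * c = b + d"
    using assms by (auto simp: d_def)
  have p: "0 < Pt * G + c"
    using assms by (simp add: add_pos_pos)
  have "(a * Pt * G + b) / (Pt * G + c) - b / c = ((a * Pt * G + b) * c - b * (Pt * G + c)) / (c * (Pt * G + c))"
    using p assms by (subst diff_frac_eq) (auto simp: mult_ac)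
  also have "(a * Pt * G + b) * c - b * (Pt * G + c) = (a * c) * (Pt * G) - b * (Pt * G)"
    by (simp add: algebra_simps)
  also have "\<dots> = Pt * G * d"
    unfolding d(2) by (simp add: algebra_simps)
  finally have e: "harvested_energy Pt t1 a b c G = t1 * (Pt * G * d / (c * (Pt * G + c)))"
    by (simp add: harvested_energy_def)
  have r: "s * c * t2 / (t1 * d) + s * c\<^sup>2 * t2 / (Pt * t1 * d) / G = s * c * t2 * (Pt * G + c) / (Pt * t1 * d * G)"
    using assms d by (simp add: field_simps power2_eq_square)
  show ?thesis
    unfolding snr_def e d_def[symmetric] r using assms d p by (simp add: mult_ac)
qed

lemma borel_measurable_snr:
  "(\<lambda>(g, h). snr Pt s t1 t2 a b c g h) \<in> borel_measurable (borel \<Otimes>\<^sub>M borel)"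
  unfolding snr_def harvested_energy_def by measurable

lemma (in prob_space) indep_var_of_indep_vars:
  assumes "indep_vars (\<lambda>_. N) X I" "i \<in> I" "j \<in> I" "i \<noteq> j"
  shows "indep_var N (X i) N (X j)"
proof -
  have "indep_var (Pi\<^sub>M {i} (\<lambda>_. N)) (\<lambda>\<omega>. restrict (\<lambda>i. X i \<omega>) {i}) (Pi\<^sub>M {j} (\<lambda>_. N)) (\<lambda>\<omega>. restrict (\<lambda>i. X i \<omega>) {j})"
    using assms by (intro indep_var_restrict[OF assms(1)]) auto
  then have "indep_var N ((\<lambda>v. v i) \<circ> (\<lambda>\<omega>. restrict (\<lambda>i. X i \<omega>) {i})) N ((\<lambda>v. v j) \<circ> (\<lambda>\<omega>. restrict (\<lambda>i. X i \<omega>) {j}))"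
    by (rule indep_var_compose) auto
  then show ?thesis
    by (simp add: o_def)
qed

text \<open>The index sum is cut into the disjoint blocks \<open>{Inl i, Inr i}\<close>; functions
  of disjoint blocks of an independent family are independent.\<close>

lemma (in prob_space) indep_vars_case_sum_combine:
  assumes ind: "indep_vars (\<lambda>_. N) (case_sum G H) (I <+> I)"
    and W: "case_prod W \<in> N \<Otimes>\<^sub>M N \<rightarrow>\<^sub>M L"
  shows "indep_vars (\<lambda>_. L) (\<lambda>i \<omega>. W (G i \<omega>) (H i \<omega>)) I"
proof -
  let ?K = "\<lambda>i. {Inl i, Inr i} :: ('b + 'b) set"
  have "indep_vars (\<lambda>i. Pi\<^sub>M (?K i) (\<lambda>_. N)) (\<lambda>i \<omega>. restrict (\<lambda>l. case_sum G H l \<omega>) (?K i)) I"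
    by (rule indep_vars_restrict[OF ind]) (auto simp: disjoint_family_on_def)
  then have "indep_vars (\<lambda>_. L) (\<lambda>i \<omega>. (\<lambda>v. W (v (Inl i)) (v (Inr i))) (restrict (\<lambda>l. case_sum G H l \<omega>) (?K i))) I"
  proof (rule indep_vars_compose2)
    fix i
    have "(\<lambda>v. (v (Inl i), v (Inr i))) \<in> Pi\<^sub>M (?K i) (\<lambda>_. N) \<rightarrow>\<^sub>M N \<Otimes>\<^sub>M N"
      by (intro measurable_Pair measurable_component_singleton) auto
    from measurable_compose[OF this W]
    show "(\<lambda>v. W (v (Inl i)) (v (Inr i))) \<in> Pi\<^sub>M (?K i) (\<lambda>_. N) \<rightarrow>\<^sub>M L"
      by simp
  qed
  then show ?thesis
    by simp
qed

lemma cdf_exp_mixture: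
  assumes "0 < Pt" "0 < s" "0 < t1" "0 < t2" "0 < c" "0 < a * c - b" "0 < u"
    and D: "prob_space D"
      "D = density lborel (\<lambda>u. ennreal (exp_mixture_density (s * c * t2 / (t1 * (a * c - b))) (s * c\<^sup>2 * t2 / (Pt * t1 * (a * c - b))) u))"
  shows "cdf D u = snr_cdf Pt s t1 t2 a b c u"
proof -
  let ?A = "s * c * t2 / (t1 * (a * c - b))" and ?B = "s * c\<^sup>2 * t2 / (Pt * t1 * (a * c - b))"
  interpret prob_space D
    by fact
  have AB: "0 < ?A" "0 < ?B"
    using assms by simp_all
  let ?t = "exp (- (u * ?A)) * (2 * sqrt (?B * u) * bessel_K 1 (2 * sqrt (?B * u)))"
  have "0 \<le> bessel_K 1 (2 * sqrt (?B * u))"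
    unfolding bessel_K_def set_lebesgue_integral_def
    by (intro Bochner_Integration.integral_nonneg) (simp add: indicator_def)
  moreover have "0 \<le> sqrt (?B * u)"
    using AB(2) assms(7) by (intro real_sqrt_ge_zero mult_nonneg_nonneg less_imp_le)
  \<comment> \<open>\<open>ennreal\<close> identifies all negative reals with 0, so the sign has to
    be known before it can be cancelled.\<close>
  ultimately have t: "0 \<le> ?t"
    by (intro mult_nonneg_nonneg exp_ge_zero zero_le_numeral)
  have "ennreal (measure D {u<..}) = ennreal ?t"
    using emeasure_exp_mixture_tail[OF AB assms(7)] unfolding D(2)[symmetric] emeasure_eq_measure .
  then have "measure D {u<..} = ?t"
    using t by (subst (asm) ennreal_inj) auto
  moreover have "measure D (space D - {u<..}) = 1 - measure D {u<..}"
    by (rule prob_compl) (simp add: D(2))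
  moreover have "space D - {u<..} = {..u}"
    by (auto simp: D(2))
  ultimately show ?thesis
    by (simp add: cdf_def snr_cdf_def mult_ac)
qed

section \<open>Joint outage probability\<close>

text \<open>\<open>deriv\<close> has an unspecified value where no derivative exists;
  differentiability and the density statement certify that the \<open>F\<close> and \<open>f\<close>
  under the integral are the law of the SNR.\<close>

theorem theorem6:
  fixes \<Omega> :: "'a measure" and g h :: "nat \<Rightarrow> 'a \<Rightarrow> complex"
    and M j k :: nat and Pt s t1 t2 a b c x :: real
    and X :: "nat \<Rightarrow> 'a \<Rightarrow> real" and Y Z :: "'a \<Rightarrow> real" and F f :: "real \<Rightarrow> real"
  assumes "prob_space \<Omega>"
    and "M \<ge> 2"
    and "\<And>i. i \<in> {1..M} \<Longrightarrow>
           distributed \<Omega> lborel (\<lambda>\<omega>. (cmod (g i \<omega>))\<^sup>2) (exponential_density 1)"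
    and "\<And>i. i \<in> {1..M} \<Longrightarrow>
           distributed \<Omega> lborel (\<lambda>\<omega>. (cmod (h i \<omega>))\<^sup>2) (exponential_density 1)"
    and "prob_space.indep_vars \<Omega> (\<lambda>_. borel)
           (case_sum (\<lambda>i \<omega>. (cmod (g i \<omega>))\<^sup>2) (\<lambda>i \<omega>. (cmod (h i \<omega>))\<^sup>2))
           ({1..M} <+> {1..M})"
    and "Pt > 0" and "s > 0" and "0 < t1" and "t1 < 1" and "t2 = 1 - t1"
    and "c > 0" and "a * c - b > 0"
    and "1 \<le> j" and "j < k" and "k \<le> M"
    and "0 < x" and "x < 1"
  defines "X \<equiv> \<lambda>i \<omega>. snr Pt s t1 t2 a b c ((cmod (g i \<omega>))\<^sup>2) ((cmod (h i \<omega>))\<^sup>2)"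
    and "Y \<equiv> \<lambda>\<omega>. nth_largest M j (\<lambda>i. X i \<omega>)"
    and "Z \<equiv> \<lambda>\<omega>. nth_largest M k (\<lambda>i. X i \<omega>)"
    and "F \<equiv> snr_cdf Pt s t1 t2 a b c"
    and "f \<equiv> deriv F"
  shows "(\<forall>i\<in>{1..M}. \<forall>u>0. cdf (distr \<Omega> borel (X i)) u = F u)
    \<and> (\<forall>u>0. F differentiable at u)
    \<and> (\<forall>i\<in>{1..M}. distributed \<Omega> lborel (X i) (\<lambda>u. if u > 0 then f u else 0))
    \<and> measure \<Omega> {\<omega> \<in> space \<Omega>. Z \<omega> / (Y \<omega> + s) \<le> x \<and> Y \<omega> / (Z \<omega> + s) \<le> x}
        = (LBINT z=0..(s * x / (1 - x)).
             (LBINT y=(max z ((z - s * x) / x))..(x * (z + s)). order_stat_density M j k F f y z))"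
proof -
  interpret prob_space \<Omega>
    by fact
  note jk = \<open>1 \<le> j\<close> \<open>j < k\<close> \<open>k \<le> M\<close>
  have t2: "0 < t2"
    using \<open>t2 = 1 - t1\<close> \<open>t1 < 1\<close> by simp
  note par = \<open>0 < Pt\<close> \<open>0 < s\<close> \<open>0 < t1\<close> t2 \<open>0 < c\<close> \<open>0 < a * c - b\<close>
  define A where "A = s * c * t2 / (t1 * (a * c - b))"
  define B where "B = s * c\<^sup>2 * t2 / (Pt * t1 * (a * c - b))"
  have AB: "0 < A" "0 < B"
    using par by (simp_all add: A_def B_def)
  define \<phi> where "\<phi> = exp_mixture_density A B"
  define D where "D = density lborel (\<lambda>u. ennreal (\<phi> u))"
  note ind = assms(5)
  have \<phi>_meas[measurable]: "\<phi> \<in> borel_measurable borel"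
    unfolding \<phi>_def by simp
  have dist: "distributed \<Omega> lborel (X i) (\<lambda>u. ennreal (\<phi> u))" if i: "i \<in> {1..M}" for i
    unfolding X_def \<phi>_def
  proof (rule distributed_exp_mixture[OF AB assms(3)[OF i] assms(4)[OF i]])
    show "indep_var borel (\<lambda>\<omega>. (cmod (g i \<omega>))\<^sup>2) borel (\<lambda>\<omega>. (cmod (h i \<omega>))\<^sup>2)"
      using indep_var_of_indep_vars[OF ind InlI[OF i] InrI[OF i]] by simp
    show "case_prod (snr Pt s t1 t2 a b c) \<in> borel_measurable (borel \<Otimes>\<^sub>M borel)"
      by (rule borel_measurable_snr)
    show "snr Pt s t1 t2 a b c G H = H / (A + B / G)" if "0 < G" for G H
      unfolding A_def B_def using par that by (rule snr_conv_exp_mixture)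
  qed
  then have X_meas: "X i \<in> borel_measurable \<Omega>" if "i \<in> {1..M}" for i
    using distributed_measurable[OF dist[OF that]] by simp
  have distr: "distr \<Omega> borel (X i) = D" if "i \<in> {1..M}" for i
    using distributed_distr_eq_density[OF dist[OF that]] by (simp add: D_def cong: distr_cong)
  have M: "1 \<in> {1..M}"
    using \<open>2 \<le> M\<close> by simp
  have D: "prob_space D"
    using prob_space_distr[OF X_meas[OF M]] unfolding distr[OF M] .
  have cdf: "cdf D u = F u" if "0 < u" for u
    unfolding F_def using par that D D_def[unfolded \<phi>_def A_def B_def] by (rule cdf_exp_mixture)
  \<comment> \<open>\<open>F\<close> is known to agree with \<open>cdf D\<close> only at positive
    arguments; as these form an open set, the derivative carries over.\<close>
  have deriv_F: "(F has_real_derivative \<phi> u) (at u)" if u: "0 < u" for u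
  proof (rule has_field_derivative_transform_within_open)
    show "(cdf D has_real_derivative \<phi> u) (at u)"
      using D D_def \<phi>_meas _ _ u
    proof (rule has_real_derivative_cdf_density)
      show "continuous_on {0<..} \<phi>"
        unfolding \<phi>_def using AB by (rule continuous_on_exp_mixture_density)
      show "0 \<le> \<phi> t" for t
        unfolding \<phi>_def using AB by (rule exp_mixture_density_nonneg)
    qed
    show "open {0::real<..}" "u \<in> {0<..}"
      using u by auto
    show "cdf D v = F v" if "v \<in> {0<..}" for v
      using cdf that by simp
  qed
  have f: "f u = \<phi> u" if "0 < u" for u
    unfolding f_def using deriv_F[OF that] by (rule DERIV_imp_deriv)
  have \<phi>_0: "\<phi> u = 0" if "u \<le> 0" for u
    using that by (simp add: \<phi>_def exp_mixture_density_def)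
  have f_eq: "(if 0 < u then f u else 0) = \<phi> u" for u
    by (simp add: f \<phi>_0)

  let ?P = "Pi\<^sub>M {1..M} (\<lambda>_. D)"
  \<comment> \<open>Restriction places the sample vector in the product space;
    \<open>nth_largest M\<close> reads only the indices \<open>1\<close> to \<open>M\<close>, so its
    values are unchanged.\<close>
  let ?V = "\<lambda>\<omega>. \<lambda>i\<in>{1..M}. X i \<omega>"
  let ?E = "{v \<in> space ?P. nth_largest M k v / (nth_largest M j v + s) \<le> x \<and>
         nth_largest M j v / (nth_largest M k v + s) \<le> x}"
  have X_indep: "indep_vars (\<lambda>_. borel) X {1..M}"
    unfolding X_def using ind borel_measurable_snr by (rule indep_vars_case_sum_combine)
  \<comment> \<open>Independence and the common law \<open>D\<close> make the vector of SNRs a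
    sample from the product measure, where the order statistics result applies.\<close>
  have PiM: "distr \<Omega> (Pi\<^sub>M {1..M} (\<lambda>_. borel)) ?V = ?P"
  proof -
    have "distr \<Omega> (Pi\<^sub>M {1..M} (\<lambda>_. borel)) ?V = Pi\<^sub>M {1..M} (\<lambda>i. distr \<Omega> borel (X i))"
      using X_indep X_meas M by (subst (asm) indep_vars_iff_distr_eq_PiM') auto
    also have "\<dots> = ?P"
      by (intro PiM_cong refl distr)
    finally show ?thesis .
  qed
  have V_meas: "?V \<in> \<Omega> \<rightarrow>\<^sub>M Pi\<^sub>M {1..M} (\<lambda>_. borel)"
    using X_meas by (rule measurable_restrict)
  have Y: "nth_largest M l (?V \<omega>) = nth_largest M l (\<lambda>i. X i \<omega>)" for l \<omega>
    by (rule nth_largest_cong) simp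
  have E: "?E \<in> sets (Pi\<^sub>M {1..M} (\<lambda>_. borel))"
  proof -
    have [measurable]: "(\<lambda>v. nth_largest M l v) \<in> borel_measurable ?P" if "l \<in> {j, k}" for l
      using that jk by (intro borel_measurable_nth_largest) (auto simp: D_def)
    have "?E \<in> sets ?P"
      by measurable
    then show ?thesis
      unfolding PiM[symmetric] by simp
  qed
  have "measure \<Omega> {\<omega> \<in> space \<Omega>. Z \<omega> / (Y \<omega> + s) \<le> x \<and> Y \<omega> / (Z \<omega> + s) \<le> x} =
      measure (distr \<Omega> (Pi\<^sub>M {1..M} (\<lambda>_. borel)) ?V) ?E"
  proof (subst measure_distr[OF V_meas E], rule arg_cong[where f="measure \<Omega>"])
    have "?V \<omega> \<in> space ?P" for \<omega>
      by (simp add: space_PiM D_def)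
    then show "{\<omega> \<in> space \<Omega>. Z \<omega> / (Y \<omega> + s) \<le> x \<and> Y \<omega> / (Z \<omega> + s) \<le> x} = ?V -` ?E \<inter> space \<Omega>"
      unfolding Y_def Z_def by (auto simp only: Y vimage_def)
  qed
  also have "\<dots> = (LBINT z=0..s * x / (1 - x). (LBINT y=max z ((z - s * x) / x)..x * (z + s).
      order_stat_density M j k (cdf D) \<phi> y z))"
    unfolding PiM using AB D D_def \<phi>_0 jk par \<open>0 < x\<close> \<open>x < 1\<close>
    by (intro measure_order_statistics_ratio) (auto simp: \<phi>_def exp_mixture_density_nonneg)
  also have "\<dots> = (LBINT z=0..s * x / (1 - x). (LBINT y=max z ((z - s * x) / x)..x * (z + s).
      order_stat_density M j k F f y z))"
  proof (rule interval_integral_cong)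
    fix z assume z: "z \<in> einterval (min 0 (ereal (s * x / (1 - x)))) (max 0 (ereal (s * x / (1 - x))))"
    have "0 < z"
      using z par(2) \<open>0 < x\<close> \<open>x < 1\<close> by (auto simp: einterval_def min_def max_def split: if_splits)
    show "(LBINT y=max z ((z - s * x) / x)..x * (z + s). order_stat_density M j k (cdf D) \<phi> y z) =
        (LBINT y=max z ((z - s * x) / x)..x * (z + s). order_stat_density M j k F f y z)"
    proof (rule interval_integral_cong)
      fix y
      assume y: "y \<in> einterval (min (ereal (max z ((z - s * x) / x))) (ereal (x * (z + s))))
          (max (ereal (max z ((z - s * x) / x))) (ereal (x * (z + s))))"
      \<comment> \<open>The congruence rule ranges between the smaller and the larger limit; as both
        are positive, so is \<open>y\<close>, and there \<open>cdf D\<close> and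
        \<open>\<phi>\<close> coincide with \<open>F\<close> and \<open>f\<close>.\<close>
      have "0 < max z ((z - s * x) / x)" "0 < x * (z + s)"
        using \<open>0 < z\<close> par(2) \<open>0 < x\<close> by (simp_all add: less_max_iff_disj add_pos_pos)
      then have "0 < y"
        using y by (auto simp: einterval_def min_def split: if_splits)
      then show "order_stat_density M j k (cdf D) \<phi> y z = order_stat_density M j k F f y z"
        using \<open>0 < z\<close> by (simp add: order_stat_density_def cdf f)
    qed
  qed
  finally have "measure \<Omega> {\<omega> \<in> space \<Omega>. Z \<omega> / (Y \<omega> + s) \<le> x \<and> Y \<omega> / (Z \<omega> + s) \<le> x} =
      (LBINT z=0..s * x / (1 - x). (LBINT y=max z ((z - s * x) / x)..x * (z + s).
        order_stat_density M j k F f y z))" .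
  moreover have "F differentiable at u" if "0 < u" for u
    using deriv_F[OF that] by (auto simp: real_differentiable_def)
  ultimately show ?thesis
    using dist cdf distr by (simp add: f_eq)
qed

end
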